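(* Let $\sigma>0$, let $r\ge0$ be a fixed integer and let $A_N=A_N'+A_N''$ be deterministic matrices in $M_N(\mathbb{C})$, $N\ge1$. Assume: (1) there is $M>0$ with $\|A_N'\|+\|A_N''\|\le M$ for all $N$; (2) for every $z\in\mathbb{C}$, $\mu_{(A_N-zI_N)(A_N-zI_N)^*}$ converges weakly to a probability measure $\nu_z$; (3) $\mathrm{supp}(\beta)=\{z\in\mathbb{C}:0\in\mathrm{supp}(\mu_z)\}$, where $\beta,\mu_z$ are the measures described in the context; (4) $D$ is an unbounded connected component of $\mathbb{C}\setminus S$, where $S=\{z\in\mathbb{C}:0\in\mathrm{supp}(\nu_z)\}$; $A_N''$ has rank $r$, and for every $z\in D$ there exists $\eta_z>0$ such that for all $N$ large enough $A_N'-zI_N$ has no singular value in $[0,\eta_z]$. Then the family of functions $f_N:D\to\mathbb{C}$, $f_N(z)=\det(A_N-zI_N)/\det(A_N'-zI_N)$, is a precompact family of analytic functions and any subsequential limit of $(f_N)$ is non-zero (i.e. not identically zero). In particular, along any converging subsequence $(f_{N_k})_{k\ge1}$, for any $B(z,t)\subset D$ and any $\delta>0$, there exist $\varepsilon>0$ and $\Gamma=B(z,t')$ with $t-\delta<t'\le t$ such that for all $k\ge1$ $$\min_{w\in\partial\Gamma}\left|\frac{\det(A_{N_k}-wI_{N_k})}{\det(A_{N_k}'-wI_{N_k})}\right|\ge\varepsilon.$$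
   Context: $\|\cdot\|$ is the operator norm; $B(z,t)$ is the closed ball of center $z$ and radius $t$ in $\mathbb{C}$. For $A\in M_N(\mathbb{C})$ with eigenvalues $\lambda_1(A),\dots,\lambda_N(A)$, $\mu_A=\frac1N\sum_i\delta_{\lambda_i(A)}$. Precompactness and limits of analytic functions on $D$ are for uniform convergence on compact subsets of $D$ (by the singular value assumption on $A_N'$, on each compact subset of $D$ the function $f_N$ is well defined and analytic for $N$ large enough). The measures $\beta$ (on $\mathbb{C}$) and $\mu_z$ (on $[0,\infty)$) depend only on $\sigma$ and $(\nu_z)_z$ and are known to be characterized as follows: if $(X_{ij})_{i,j\ge1}$ are i.i.d. complex random variables with mean $0$ and $\mathbb{E}|X_{ij}|^2=1$, $X_N=(X_{ij})_{1\le i,j\le N}$ and $M_N=A_N+\sigma X_N/\sqrt N$, then almost surely $\mu_{M_N}\to\beta$ weakly and, for each $z$, almost surely $\mu_{(M_N-zI_N)(M_N-zI_N)^*}\to\mu_z$ weakly. *)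

theory Defs
  imports
    "HOL-Probability.Probability"
    "HOL-Complex_Analysis.Complex_Analysis"
    "Jordan_Normal_Form.Schur_Decomposition"
    "Jordan_Normal_Form.DL_Rank"
begin

definition vnorm :: "complex Matrix.vec \<Rightarrow> real" where
  "vnorm v = L2_set (\<lambda>i. cmod (vec_index v i)) {..<dim_vec v}"

definition op_norm :: "complex mat \<Rightarrow> real" where
  "op_norm A = Sup {vnorm (A *\<^sub>v v) | v. v \<in> carrier_vec (dim_col A) \<and> vnorm v \<le> 1}"

definition mat_shift :: "complex mat \<Rightarrow> complex \<Rightarrow> complex mat" where
  "mat_shift A z = A - z \<cdot>\<^sub>m 1\<^sub>m (dim_row A)"

definition is_singular_value :: "complex mat \<Rightarrow> real \<Rightarrow> bool" where
  "is_singular_value A s \<longleftrightarrow> s \<ge> 0 \<and> eigenvalue (A * mat_adjoint A) (complex_of_real (s\<^sup>2))"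

text \<open>
  Empirical spectral measure, eigenvalues being counted with algebraic multiplicity.
  For a \<open>0 \<times> 0\<close> matrix the value is unspecified.
\<close>

definition esd :: "complex mat \<Rightarrow> complex measure" where
  "esd A = distr (measure_pmf (pmf_of_multiset (proots (char_poly A)))) borel (\<lambda>x. x)"

text \<open>
  Empirical spectral measure of \<open>A A\<^sup>*\<close> as a measure on the real line: the eigenvalues of
  \<open>A A\<^sup>*\<close> are real, so \<^const>\<open>Re\<close> merely changes their type.
\<close>

definition esd_sq :: "complex mat \<Rightarrow> real measure" where
  "esd_sq A = distr (esd (A * mat_adjoint A)) borel Re"

text \<open>
  Weak convergence of probability measures on the complex plane; for measures on the real line
  we use the library's \<^const>\<open>weak_conv_m\<close>.
\<close>

definition weak_conv_complex :: "(nat \<Rightarrow> complex measure) \<Rightarrow> complex measure \<Rightarrow> bool" where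
  "weak_conv_complex M L \<longleftrightarrow>
     (\<forall>f :: complex \<Rightarrow> real. continuous_on UNIV f \<and> bounded (range f) \<longrightarrow>
        (\<lambda>n. \<integral>x. f x \<partial>M n) \<longlonglongrightarrow> (\<integral>x. f x \<partial>L))"

definition msupp :: "'a :: topological_space measure \<Rightarrow> 'a set" where
  "msupp M = {x. \<forall>U. open U \<and> x \<in> U \<longrightarrow> emeasure M U > 0}"

definition iid_standard_array :: "'w measure \<Rightarrow> (nat \<times> nat \<Rightarrow> 'w \<Rightarrow> complex) \<Rightarrow> bool" where
  "iid_standard_array P X \<longleftrightarrow>
     prob_space P \<and>
     prob_space.indep_vars P (\<lambda>_. borel) X UNIV \<and>
     (\<forall>p q. distr P borel (X p) = distr P borel (X q)) \<and>
     (\<forall>p. has_bochner_integral P (X p) 0) \<and>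
     (\<forall>p. has_bochner_integral P (\<lambda>\<omega>. (cmod (X p \<omega>))\<^sup>2) 1)"

text \<open>The deformed matrix \<open>M\<^sub>N = A\<^sub>N + \<sigma> X\<^sub>N / \<surd>N\<close>; rows and columns are numbered from 0.\<close>

definition deformed ::
  "real \<Rightarrow> (nat \<Rightarrow> complex mat) \<Rightarrow> (nat \<times> nat \<Rightarrow> 'w \<Rightarrow> complex) \<Rightarrow> 'w \<Rightarrow> nat \<Rightarrow> complex mat"
where
  "deformed \<sigma> A X \<omega> N =
     A N + complex_of_real (\<sigma> / sqrt (real N)) \<cdot>\<^sub>m Matrix.mat N N (\<lambda>p. X p \<omega>)"

definition limit_measures ::
  "'w measure \<Rightarrow> (nat \<times> nat \<Rightarrow> 'w \<Rightarrow> complex) \<Rightarrow> real \<Rightarrow> (nat \<Rightarrow> complex mat) \<Rightarrow>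
     complex measure \<Rightarrow> (complex \<Rightarrow> real measure) \<Rightarrow> bool"
where
  "limit_measures P X \<sigma> A \<beta> \<mu> \<longleftrightarrow>
     prob_space \<beta> \<and> sets \<beta> = sets borel \<and> (\<forall>z. real_distribution (\<mu> z)) \<and>
     (AE \<omega> in P. weak_conv_complex (\<lambda>N. esd (deformed \<sigma> A X \<omega> N)) \<beta>) \<and>
     (\<forall>z. AE \<omega> in P. weak_conv_m (\<lambda>N. esd_sq (mat_shift (deformed \<sigma> A X \<omega> N) z)) (\<mu> z))"

text \<open>
  \<open>f\<^sub>N(z) = det(A\<^sub>N - z I) / det(A'\<^sub>N - z I)\<close>. Where the denominator vanishes the quotient is 0
  by the convention of the logic; this concerns only finitely many \<open>z\<close> for each \<open>N\<close>.
\<close>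

definition det_ratio ::
  "(nat \<Rightarrow> complex mat) \<Rightarrow> (nat \<Rightarrow> complex mat) \<Rightarrow> nat \<Rightarrow> complex \<Rightarrow> complex" where
  "det_ratio A A' N z = Determinant.det (mat_shift (A N) z) / Determinant.det (mat_shift (A' N) z)"

definition converges_locally_uniformly ::
  "complex set \<Rightarrow> (nat \<Rightarrow> complex \<Rightarrow> complex) \<Rightarrow> (complex \<Rightarrow> complex) \<Rightarrow> bool" where
  "converges_locally_uniformly D F g \<longleftrightarrow>
     (\<forall>K. compact K \<and> K \<subseteq> D \<longrightarrow> uniform_limit K F g sequentially)"

end

theory Submission
  imports
    Defs
    "Jordan_Normal_Form.Jordan_Normal_Form_Uniqueness"
    "Jordan_Normal_Form.Spectral_Radius"
begin

text \<open>
  The quotient \<open>det X / det Y\<close> equals \<open>det (1 - K)\<close> for \<open>K = Y\<^sup>-\<^sup>1 (Y - X)\<close>. If \<open>Y - X\<close> has rank \<open>r\<close> and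
  norm at most \<open>M\<close>, and \<open>Y\<close> is bounded below by \<open>\<eta>\<close>, then all but \<open>r\<close> eigenvalues of \<open>K\<close> vanish and the
  others are at most \<open>M / \<eta>\<close> in modulus, so the quotient is at most \<open>(1 + M / \<eta>)\<^sup>r\<close>, whatever the dimension.
  Applied to \<open>X = A\<^sub>N - w\<close> and \<open>Y = A'\<^sub>N - w\<close> with \<open>w\<close> near a point of \<open>D\<close>, this bounds \<open>f\<^sub>N\<close> locally, and
  Montel's theorem gives precompactness. With the roles of \<open>X\<close> and \<open>Y\<close> exchanged at a point of the
  unbounded set \<open>D\<close> of modulus at least \<open>M + 1\<close>, it bounds \<open>1 / f\<^sub>N\<close>, so no limit vanishes identically.
  A limit then has finitely many zeros in a closed disc, and almost every circle avoids these and the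
  countably many zeros and poles of the functions \<open>f\<^sub>N\<close>.

  The limits extend holomorphically to an open connected neighbourhood of \<open>D\<close>, which makes it
  unnecessary to know that \<open>S\<close> is closed.
\<close>

section \<open>Determinants of low-rank perturbations\<close>

lemma vnorm_nonneg [simp]: "0 \<le> vnorm v"
  by (simp add: vnorm_def L2_set_nonneg)

lemma vnorm_smult: "vnorm (a \<cdot>\<^sub>v v) = cmod a * vnorm v"
proof -
  have "vnorm (a \<cdot>\<^sub>v v) = L2_set (\<lambda>i. cmod a * cmod (vec_index v i)) {..<dim_vec v}"
    by (auto simp: vnorm_def norm_mult intro!: L2_set_cong)
  then show ?thesis
    by (simp add: vnorm_def L2_set_right_distrib)
qed

lemma vnorm_eq_0_iff: "v \<in> carrier_vec n \<Longrightarrow> vnorm v = 0 \<longleftrightarrow> v = 0\<^sub>v n"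
  by (auto simp: vnorm_def L2_set_eq_0_iff)

lemma vnorm_zero [simp]: "vnorm (0\<^sub>v n) = 0"
  using vnorm_eq_0_iff[of "0\<^sub>v n" n] by simp

lemma vnorm_pos: "v \<in> carrier_vec n \<Longrightarrow> v \<noteq> 0\<^sub>v n \<Longrightarrow> 0 < vnorm v"
  using vnorm_eq_0_iff[of v n] vnorm_nonneg[of v] by linarith

lemma vnorm_add_le:
  assumes "u \<in> carrier_vec n" "v \<in> carrier_vec n"
  shows "vnorm (u + v) \<le> vnorm u + vnorm v"
proof -
  have "vnorm (u + v) \<le> L2_set (\<lambda>i. cmod (vec_index u i) + cmod (vec_index v i)) {..<n}"
    using assms unfolding vnorm_def by (auto intro!: L2_set_mono norm_triangle_ineq)
  also have "\<dots> \<le> L2_set (\<lambda>i. cmod (vec_index u i)) {..<n} + L2_set (\<lambda>i. cmod (vec_index v i)) {..<n}"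
    by (rule L2_set_triangle_ineq)
  finally show ?thesis
    using assms by (simp add: vnorm_def)
qed

lemma cmod_index_le_vnorm: "i < dim_vec v \<Longrightarrow> cmod (vec_index v i) \<le> vnorm v"
  unfolding vnorm_def by (rule member_le_L2_set) auto

lemma vnorm_mult_mat_vec_le_sum:
  assumes v: "v \<in> carrier_vec (dim_col A)"
  shows "vnorm (A *\<^sub>v v) \<le> (\<Sum>i<dim_row A. \<Sum>j<dim_col A. cmod (A $$ (i,j))) * vnorm v"
proof -
  have "vnorm (A *\<^sub>v v) \<le> (\<Sum>i<dim_row A. cmod (vec_index (A *\<^sub>v v) i))"
    unfolding vnorm_def using L2_set_le_sum[of "{..<dim_row A}" "\<lambda>i. cmod (vec_index (A *\<^sub>v v) i)"]
    by simp
  also have "\<dots> \<le> (\<Sum>i<dim_row A. \<Sum>j<dim_col A. cmod (A $$ (i,j)) * vnorm v)"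
  proof (rule sum_mono)
    fix i assume i: "i \<in> {..<dim_row A}"
    have "cmod (vec_index (A *\<^sub>v v) i) \<le> (\<Sum>j\<in>{0..<dim_col A}. cmod (A $$ (i,j) * vec_index v j))"
      using i v by (auto simp: scalar_prod_def intro!: sum_norm_le)
    also have "\<dots> \<le> (\<Sum>j\<in>{0..<dim_col A}. cmod (A $$ (i,j)) * vnorm v)"
      using v by (intro sum_mono) (auto simp: norm_mult intro!: mult_left_mono cmod_index_le_vnorm)
    finally show "cmod (vec_index (A *\<^sub>v v) i) \<le> (\<Sum>j<dim_col A. cmod (A $$ (i,j)) * vnorm v)"
      by (simp add: atLeast0LessThan)
  qed
  finally show ?thesis
    by (simp add: sum_distrib_right)
qed

text \<open>This gives the supremum in \<open>op_norm\<close> its meaning: \<open>Sup\<close> is of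
  use only for a set of reals that is bounded above.\<close>

lemma vnorm_mult_mat_vec_bdd_above:
  "bdd_above {vnorm (A *\<^sub>v v) | v. v \<in> carrier_vec (dim_col A) \<and> vnorm v \<le> 1}"
proof -
  define C where "C = (\<Sum>i<dim_row A. \<Sum>j<dim_col A. cmod (A $$ (i,j)))"
  have "0 \<le> C"
    unfolding C_def by (intro sum_nonneg) auto
  have "vnorm (A *\<^sub>v v) \<le> C" if "v \<in> carrier_vec (dim_col A)" "vnorm v \<le> 1" for v
    using vnorm_mult_mat_vec_le_sum[OF that(1)] mult_left_mono[OF that(2) \<open>0 \<le> C\<close>]
    by (simp add: C_def)
  then show ?thesis
    by (auto simp: bdd_above_def)
qed

lemma vnorm_mult_mat_vec_le:
  assumes "v \<in> carrier_vec (dim_col A)"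
  shows "vnorm (A *\<^sub>v v) \<le> op_norm A * vnorm v"
proof (cases "v = 0\<^sub>v (dim_col A)")
  case True
  have "A *\<^sub>v 0\<^sub>v (dim_col A) = 0\<^sub>v (dim_row A)"
    by (intro eq_vecI) auto
  then show ?thesis
    unfolding True by simp
next
  case False
  define c where "c = complex_of_real (1 / vnorm v)"
  have pos: "0 < vnorm v"
    using vnorm_pos[OF assms False] .
  have "vnorm (c \<cdot>\<^sub>v v) \<le> 1"
    unfolding vnorm_smult c_def using pos by (simp add: norm_divide)
  then have "vnorm (A *\<^sub>v (c \<cdot>\<^sub>v v)) \<le> op_norm A"
    unfolding op_norm_def
    by (intro cSup_upper vnorm_mult_mat_vec_bdd_above CollectI exI[of _ "c \<cdot>\<^sub>v v"])
       (use assms in auto)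
  moreover have "A *\<^sub>v (c \<cdot>\<^sub>v v) = c \<cdot>\<^sub>v (A *\<^sub>v v)"
    using assms by (intro mult_mat_vec) auto
  ultimately show ?thesis
    unfolding vnorm_smult using pos by (simp add: vnorm_smult c_def norm_divide field_simps)
qed

lemma op_norm_nonneg: "0 \<le> op_norm A"
proof -
  have "vnorm (A *\<^sub>v 0\<^sub>v (dim_col A)) \<le> op_norm A"
    unfolding op_norm_def
    by (intro cSup_upper vnorm_mult_mat_vec_bdd_above CollectI exI[of _ "0\<^sub>v (dim_col A)"]) auto
  then show ?thesis
    using vnorm_nonneg order_trans by blast
qed

section \<open>Rank, kernel and the multiplicity of the eigenvalue 0\<close>

text \<open>Rank-nullity for the map given by \<open>A\<close>. It turns the rank hypothesis into
  one on the kernel, which is visibly unchanged under left multiplication by an invertible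
  matrix.\<close>

lemma kernel_dim_rank:
  fixes A :: "'a :: field mat"
  assumes A: "A \<in> carrier_mat m n"
  shows "vec_space.rank m A + kernel_dim A = n"
proof -
  interpret W: vec_space "TYPE('a)" m .
  interpret K: kernel m n A by unfold_locales fact
  interpret linear_map class_ring K.NC.V W.V "\<lambda>v. A *\<^sub>v v"
    using A mult_add_distrib_mat_vec[OF A] mult_mat_vec[OF A]
    by unfold_locales (auto simp: module_hom_def)
  have "imT = W.span (set (cols A))"
    using W.col_space_eq[OF A] A by (auto simp: im_def W.col_space_def)
  moreover have "kerT = mat_kernel A"
    using A by (auto simp: ker_def mat_kernel_def)
  ultimately show ?thesis
    using rank_nullity A unfolding W.rank_def kernel_dim_def K.NC.dim_is_n
    by simp
qed

text \<open>Geometric against algebraic multiplicity, read off the Jordan form: a block for the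
  eigenvalue 0 contributes at most one dimension to the kernel, but its whole size to the order of
  the root 0.\<close>

lemma kernel_dim_le_order_char_poly:
  fixes K :: "complex mat"
  assumes K: "K \<in> carrier_mat n n"
  shows "kernel_dim K \<le> Polynomial.order 0 (char_poly K)"
proof -
  obtain as where "char_poly K = (\<Prod>a\<leftarrow>as. [:- a, 1:])"
    using char_poly_factorized[OF K] by blast
  then obtain n_as where jnf: "jordan_nf K n_as"
    using jordan_nf_exists[OF K] by blast
  have "char_matrix K 0 = K"
    using K by (intro eq_matI) (auto simp: char_matrix_def)
  then have "kernel_dim K = dim_gen_eigenspace K 0 1"
    using K by (simp add: dim_gen_eigenspace_def)
  also have "\<dots> = (\<Sum>n\<leftarrow>map fst [(n, e)\<leftarrow>n_as . e = 0]. min 1 n)"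
    by (rule dim_gen_eigenspace[OF jnf])
  also have "\<dots> \<le> (\<Sum>n\<leftarrow>map fst [(n, e)\<leftarrow>n_as . e = 0]. n)"
    by (rule sum_list_mono) simp
  also have "\<dots> = Polynomial.order 0 (char_poly K)"
    unfolding jordan_nf_order[OF jnf] by (simp add: case_prod_unfold)
  finally show ?thesis .
qed

lemma order_prod_list_linear:
  fixes as :: "'a :: idom list"
  shows "Polynomial.order c (\<Prod>a\<leftarrow>as. [:- a, 1:]) = count_list as c"
proof (induction as)
  case (Cons a as)
  have "Polynomial.order c [:- a, 1:] = (if c = a then 1 else 0)"
    using order_linear_power[of c "- a" 1] by auto
  moreover have "(\<Prod>a\<leftarrow>as. [:- a, 1:]) \<noteq> 0"
    by (auto simp: prod_list_zero_iff)
  ultimately show ?case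
    using Cons by (simp add: order_mult del: mult_pCons_left)
qed simp

text \<open>A root 0 contributes the factor 1 and any other root a factor of modulus at most 1 + C.
  Only the number of nonzero roots enters the exponent, so the bound can be independent of the
  dimension.\<close>

lemma cmod_poly_prod_list_le:
  assumes "\<And>a. a \<in> set as \<Longrightarrow> cmod a \<le> C"
  shows "cmod (poly (\<Prod>a\<leftarrow>as. [:- a, 1:]) 1) \<le> (1 + C) ^ (length as - count_list as 0)"
  using assms
proof (induction as)
  case (Cons a as)
  have IH: "cmod (poly (\<Prod>a\<leftarrow>as. [:- a, 1:]) 1) \<le> (1 + C) ^ (length as - count_list as 0)"
    using Cons by auto
  have "count_list as 0 \<le> length as"
    by (rule count_le_length)
  show ?case
  proof (cases "a = 0")
    case True
    then show ?thesis
      using IH by (simp add: norm_mult)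
  next
    case False
    have "cmod (1 - a) \<le> 1 + C"
      using norm_triangle_ineq4[of 1 a] Cons.prems[of a] by simp
    moreover have "0 \<le> C"
      using Cons.prems[of a] norm_ge_zero[of a] by (meson list.set_intros(1) order_trans)
    ultimately have "cmod (1 - a) * cmod (poly (\<Prod>a\<leftarrow>as. [:- a, 1:]) 1)
        \<le> (1 + C) * (1 + C) ^ (length as - count_list as 0)"
      using IH by (intro mult_mono) auto
    then show ?thesis
      using False \<open>count_list as 0 \<le> length as\<close> by (simp add: norm_mult Suc_diff_le flip: left_diff_distrib[of 1 a, simplified])
  qed
qed simp

text \<open>The bounds are stated on vectors and the rank through the kernel, so that the two
  shifted matrices can be substituted for \<open>X\<close> and \<open>Y\<close> in either
  order.\<close>

lemma cmod_det_le_of_low_rank_difference: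
  fixes X Y :: "complex mat"
  assumes X: "X \<in> carrier_mat n n" and Y: "Y \<in> carrier_mat n n"
    and lower: "\<forall>v\<in>carrier_vec n. \<eta> * vnorm v \<le> vnorm (Y *\<^sub>v v)" and "\<eta> > 0"
    and upper: "\<forall>v\<in>carrier_vec n. vnorm ((Y - X) *\<^sub>v v) \<le> M * vnorm v" and "M \<ge> 0"
    and ker: "n \<le> kernel_dim (Y - X) + r"
  shows "det Y \<noteq> 0" "cmod (det X) \<le> (1 + M / \<eta>) ^ r * cmod (det Y)"
proof -
  show detY: "det Y \<noteq> 0"
  proof
    assume "det Y = 0"
    then obtain v where v: "v \<in> carrier_vec n" "v \<noteq> 0\<^sub>v n" "Y *\<^sub>v v = 0\<^sub>v n"
      using det_0_iff_vec_prod_zero[OF Y] by blast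
    then show False
      using lower[rule_format, OF v(1)] vnorm_pos[OF v(1,2)] \<open>\<eta> > 0\<close> by (simp add: mult_le_0_iff)
  qed
  obtain Z where Z: "Z \<in> carrier_mat n n" and ZY: "Z * Y = 1\<^sub>m n" and YZ: "Y * Z = 1\<^sub>m n"
    using det_non_zero_imp_unit[OF Y detY, of undefined]
    by (auto simp: Units_def ring_mat_def)
  define E where "E = Y - X"
  define K where "K = Z * E"
  have E: "E \<in> carrier_mat n n" and K: "K \<in> carrier_mat n n"
    using X Y Z by (auto simp: E_def K_def)
  have YK: "Y * K = E"
    using assoc_mult_mat[OF Y Z E] YZ E by (simp add: K_def)
  \<comment> \<open>\<open>Z\<close> is invertible, so \<open>K\<close> inherits the large kernel of
    \<open>E\<close>.\<close>
  have "mat_kernel K = mat_kernel E"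
    unfolding K_def by (rule mat_kernel_mult_eq[OF E Z Y YZ])
  then have kdim: "kernel_dim K = kernel_dim E"
    using K E by (simp add: kernel_dim_def)
  \<comment> \<open>For an eigenvector v, applying \<open>Y\<close> to K v = a v gives E v = a (Y
    v). The left side has norm at most M times that of v, the right side at least |a| \<eta> times
    it.\<close>
  have ev: "cmod a \<le> M / \<eta>" if a: "eigenvalue K a" for a
  proof -
    obtain v where v: "v \<in> carrier_vec n" "v \<noteq> 0\<^sub>v n" "K *\<^sub>v v = a \<cdot>\<^sub>v v"
      using a K by (auto simp: eigenvalue_def eigenvector_def)
    have "E *\<^sub>v v = Y *\<^sub>v (K *\<^sub>v v)"
      using YK assoc_mult_mat_vec[OF Y K v(1)] by simp
    also have "\<dots> = a \<cdot>\<^sub>v (Y *\<^sub>v v)"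
      unfolding v(3) by (rule mult_mat_vec[OF Y v(1)])
    finally have "cmod a * vnorm (Y *\<^sub>v v) \<le> M * vnorm v"
      using upper[rule_format, OF v(1)] by (simp add: vnorm_smult E_def)
    moreover have "cmod a * (\<eta> * vnorm v) \<le> cmod a * vnorm (Y *\<^sub>v v)"
      using lower[rule_format, OF v(1)] by (intro mult_left_mono) auto
    ultimately have "(cmod a * \<eta>) * vnorm v \<le> M * vnorm v"
      by (simp add: mult.assoc)
    then have "cmod a * \<eta> \<le> M"
      using vnorm_pos[OF v(1,2)] by simp
    then show ?thesis
      using \<open>\<eta> > 0\<close> by (simp add: field_simps)
  qed
  obtain as where as: "char_poly K = (\<Prod>a\<leftarrow>as. [:- a, 1:])" "length as = n"
    using char_poly_factorized[OF K] by blast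
  have "eigenvalue K a" if "a \<in> set as" for a
    unfolding eigenvalue_root_char_poly[OF K] as(1)
    using that by (auto simp: poly_prod_list prod_list_zero_iff o_def)
  then have "cmod (poly (char_poly K) 1) \<le> (1 + M / \<eta>) ^ (length as - count_list as 0)"
    unfolding as(1) using ev by (intro cmod_poly_prod_list_le) auto
  also have "\<dots> \<le> (1 + M / \<eta>) ^ r"
  proof (rule power_increasing)
    \<comment> \<open>The list has n entries, and 0 occurs in it at least
      \<open>kernel_dim E\<close> times, that is, at least n - r times.\<close>
    show "length as - count_list as 0 \<le> r"
      using kernel_dim_le_order_char_poly[OF K] ker kdim
      by (simp add: as order_prod_list_linear E_def)
  qed (use \<open>M \<ge> 0\<close> \<open>\<eta> > 0\<close> in auto)
  also have "poly (char_poly K) 1 = det (1\<^sub>m n - K)"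
    unfolding char_poly_matrix[OF K] using K
    by (intro arg_cong[of _ _ det] eq_matI) (auto simp: char_matrix_def)
  finally have "cmod (det (1\<^sub>m n - K)) \<le> (1 + M / \<eta>) ^ r" .
  moreover have "X = Y * (1\<^sub>m n - K)"
  proof -
    have "Y * (1\<^sub>m n - K) = Y * 1\<^sub>m n - Y * K"
      by (rule mult_minus_distrib_mat[OF Y _ K]) simp
    also have "\<dots> = Y - E"
      using Y by (simp add: YK)
    also have "\<dots> = X"
      using X Y by (intro eq_matI) (auto simp: E_def)
    finally show ?thesis ..
  qed
  then have "det X = det Y * det (1\<^sub>m n - K)"
    using det_mult[OF Y minus_carrier_mat[OF K]] by simp
  ultimately show "cmod (det X) \<le> (1 + M / \<eta>) ^ r * cmod (det Y)"
    by (simp add: norm_mult mult.commute mult_left_mono)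
qed

section \<open>Lower bounds from singular values\<close>

lemma mat_adjoint_carrier: "A \<in> carrier_mat m n \<Longrightarrow> mat_adjoint A \<in> carrier_mat n m"
  unfolding mat_adjoint_def by (auto simp: mat_of_rows_def)

lemma mat_adjoint_index:
  "i < dim_col A \<Longrightarrow> j < dim_row A \<Longrightarrow> mat_adjoint A $$ (i, j) = conjugate (A $$ (j, i))"
  unfolding mat_adjoint_def by (auto simp: mat_of_rows_def)

lemma mat_adjoint_adjoint [simp]: "mat_adjoint (mat_adjoint A) = A"
  using mat_adjoint_carrier[of A "dim_row A" "dim_col A"]
  by (intro eq_matI) (auto simp: mat_adjoint_index dest: mat_adjoint_carrier)

lemma mat_adjoint_one: "mat_adjoint (1\<^sub>m n :: complex mat) = 1\<^sub>m n"
  using mat_adjoint_carrier[of "1\<^sub>m n :: complex mat" n n]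
  by (intro eq_matI) (auto simp: mat_adjoint_index conjugate_complex_def)

lemma mat_adjoint_mult:
  fixes A B :: "complex mat"
  assumes A: "A \<in> carrier_mat l m" and B: "B \<in> carrier_mat m n"
  shows "mat_adjoint (A * B) = mat_adjoint B * mat_adjoint A"
proof (rule eq_matI)
  note A' = mat_adjoint_carrier[OF A] and B' = mat_adjoint_carrier[OF B]
  fix i j assume "i < dim_row (mat_adjoint B * mat_adjoint A)" "j < dim_col (mat_adjoint B * mat_adjoint A)"
  then have ij: "i < n" "j < l"
    using A' B' by auto
  then show "mat_adjoint (A * B) $$ (i, j) = (mat_adjoint B * mat_adjoint A) $$ (i, j)"
    using A B A' B' by (auto simp: mat_adjoint_index scalar_prod_def mult.commute intro!: sum.cong)
qed (use mat_adjoint_carrier[OF mult_carrier_mat[OF A B]] mat_adjoint_carrier[OF A]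
      mat_adjoint_carrier[OF B] in auto)

lemma cscalar_prod_eq_sum:
  fixes u v :: "complex vec"
  assumes "v \<in> carrier_vec n"
  shows "u \<bullet>c v = (\<Sum>i<n. vec_index u i * cnj (vec_index v i))"
  using assms by (auto simp: scalar_prod_def atLeast0LessThan)

lemma cscalar_prod_adjoint:
  fixes A :: "complex mat"
  assumes A: "A \<in> carrier_mat m n" and u: "u \<in> carrier_vec n" and w: "w \<in> carrier_vec m"
  shows "(A *\<^sub>v u) \<bullet>c w = u \<bullet>c (mat_adjoint A *\<^sub>v w)"
proof -
  have A': "mat_adjoint A \<in> carrier_mat n m"
    by (rule mat_adjoint_carrier[OF A])
  have "(A *\<^sub>v u) \<bullet>c w = (\<Sum>i<m. \<Sum>j<n. A $$ (i,j) * vec_index u j * cnj (vec_index w i))"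
    using A u unfolding cscalar_prod_eq_sum[OF w]
    by (auto simp: scalar_prod_def atLeast0LessThan sum_distrib_right intro!: sum.cong)
  also have "\<dots> = (\<Sum>j<n. \<Sum>i<m. A $$ (i,j) * vec_index u j * cnj (vec_index w i))"
    by (rule sum.swap)
  also have "\<dots> = u \<bullet>c (mat_adjoint A *\<^sub>v w)"
    using A A' w unfolding cscalar_prod_eq_sum[OF mult_mat_vec_carrier[OF A' w]]
    by (auto simp: scalar_prod_def atLeast0LessThan sum_distrib_left mat_adjoint_index
        mult_ac intro!: sum.cong)
  finally show ?thesis .
qed

lemma cscalar_prod_self: "v \<bullet>c v = complex_of_real ((vnorm v)\<^sup>2)"
proof -
  have "v \<bullet>c v = (\<Sum>i<dim_vec v. complex_of_real ((cmod (vec_index v i))\<^sup>2))"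
    by (subst cscalar_prod_eq_sum[of v "dim_vec v"]) (auto simp: complex_norm_square simp del: of_real_power intro!: sum.cong)
  then show ?thesis
    by (simp add: vnorm_def L2_set_def sum_nonneg)
qed

lemma cmod_cscalar_prod_le:
  assumes "u \<in> carrier_vec n" "v \<in> carrier_vec n"
  shows "cmod (u \<bullet>c v) \<le> vnorm u * vnorm v"
proof -
  have "cmod (u \<bullet>c v) \<le> (\<Sum>i<n. \<bar>cmod (vec_index u i)\<bar> * \<bar>cmod (vec_index v i)\<bar>)"
    unfolding cscalar_prod_eq_sum[OF assms(2)] by (intro sum_norm_le) (simp add: norm_mult)
  also have "\<dots> \<le> vnorm u * vnorm v"
    unfolding vnorm_def using assms
      L2_set_mult_ineq[of "\<lambda>i. cmod (vec_index u i)" "\<lambda>i. cmod (vec_index v i)" "{..<n}"] by simp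
  finally show ?thesis .
qed

text \<open>Self-adjointness makes \<open>k \<mapsto> \<parallel>G\<^sup>k v\<parallel>\<close> log-convex enough that \<open>(\<parallel>G v\<parallel> / \<parallel>v\<parallel>) ^ 2\<^sup>j\<close> is at most
  \<open>\<parallel>G ^ 2\<^sup>j v\<parallel> / \<parallel>v\<parallel>\<close>, which is bounded in \<open>j\<close>.\<close>

lemma self_adjoint_power_bounded_imp_contraction:
  fixes G :: "complex mat"
  assumes G: "G \<in> carrier_mat n n" and adj: "mat_adjoint G = G"
    and bound: "\<And>k. norm_bound (G ^\<^sub>m k) c" and v: "v \<in> carrier_vec n"
  shows "vnorm (G *\<^sub>v v) \<le> vnorm v"
proof (cases "v = 0\<^sub>v n")
  case True
  then show ?thesis
    using vnorm_mult_mat_vec_le[of v G] v G by simp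
next
  case False
  define f where "f = (\<lambda>v. G *\<^sub>v v)"
  define b where "b k = vnorm ((f ^^ k) v) / vnorm v" for k
  have pos: "0 < vnorm v"
    by (rule vnorm_pos[OF v False])
  have f_carrier: "(f ^^ k) u \<in> carrier_vec n" if "u \<in> carrier_vec n" for k u
    using that G by (induction k) (auto simp: f_def)
  have f_pow: "(f ^^ k) u = G ^\<^sub>m k *\<^sub>v u" if "u \<in> carrier_vec n" for k u
    using that
  proof (induction k arbitrary: u)
    case 0
    then show ?case
      using G by auto
  next
    case (Suc k)
    have "(f ^^ Suc k) u = (f ^^ k) (G *\<^sub>v u)"
      by (simp only: funpow_Suc_right o_apply f_def)
    also have "\<dots> = G ^\<^sub>m k *\<^sub>v (G *\<^sub>v u)"
      using Suc.prems G by (intro Suc.IH) auto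
    also have "\<dots> = G ^\<^sub>m Suc k *\<^sub>v u"
      using assoc_mult_mat_vec[OF pow_carrier_mat[OF G] G Suc.prems] by simp
    finally show ?case .
  qed
  have f_adj: "(f ^^ k) u \<bullet>c w = u \<bullet>c (f ^^ k) w" if "u \<in> carrier_vec n" "w \<in> carrier_vec n" for k u w
    using that
  proof (induction k arbitrary: w)
    case (Suc k)
    have "(f ^^ Suc k) u \<bullet>c w = (f ^^ k) u \<bullet>c f w"
      using cscalar_prod_adjoint[OF G f_carrier[OF Suc.prems(1)] Suc.prems(2)] adj
      by (simp add: f_def)
    also have "\<dots> = u \<bullet>c (f ^^ k) (f w)"
      using Suc.prems f_carrier[OF Suc.prems(2), of 1] by (intro Suc.IH) auto
    finally show ?case
      by (simp add: funpow_swap1)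
  qed simp
  \<comment> \<open>Self-adjointness moves k factors of \<open>G\<close> to the other side of the
    inner product; Cauchy-Schwarz does the rest.\<close>
  have square: "(b k)\<^sup>2 \<le> b (k + k)" for k
  proof -
    have "(vnorm ((f ^^ k) v))\<^sup>2 = cmod ((f ^^ k) v \<bullet>c (f ^^ k) v)"
      unfolding cscalar_prod_self norm_of_real by simp
    also have "\<dots> = cmod (v \<bullet>c (f ^^ (k + k)) v)"
      using f_adj[OF v f_carrier[OF v]] by (simp add: funpow_add)
    also have "\<dots> \<le> vnorm v * vnorm ((f ^^ (k + k)) v)"
      by (rule cmod_cscalar_prod_le[OF v f_carrier[OF v]])
    finally show ?thesis
      using pos by (simp add: b_def power_divide divide_simps power2_eq_square mult_ac)
  qed
  have b_nonneg: "0 \<le> b k" for k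
    using pos by (simp add: b_def)
  have power: "b 1 ^ (2 ^ j) \<le> b (2 ^ j)" for j
  proof (induction j)
    case (Suc j)
    have "b 1 ^ (2 ^ Suc j) = (b 1 ^ (2 ^ j))\<^sup>2"
      by (simp add: power_mult mult.commute flip: power_mult)
    also have "\<dots> \<le> (b (2 ^ j))\<^sup>2"
      using Suc b_nonneg by (intro power_mono) auto
    also have "\<dots> \<le> b (2 ^ Suc j)"
      using square[of "2 ^ j"] by (simp add: mult_2)
    finally show ?case .
  qed simp
  \<comment> \<open>Every entry of every power is at most c in modulus, and there are n * n
    entries.\<close>
  have bounded: "b k \<le> real n * (real n * c)" for k
  proof -
    have Gk: "G ^\<^sub>m k \<in> carrier_mat n n"
      by (rule pow_carrier_mat[OF G])
    have "vnorm ((f ^^ k) v) \<le> (\<Sum>i<n. \<Sum>j<n. cmod ((G ^\<^sub>m k) $$ (i,j))) * vnorm v"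
      using vnorm_mult_mat_vec_le_sum[of v "G ^\<^sub>m k", unfolded carrier_matD[OF Gk]] v
      by (simp add: f_pow)
    also have "\<dots> \<le> (\<Sum>i<n. \<Sum>j<n. c) * vnorm v"
      using bound[of k, unfolded norm_bound_def carrier_matD[OF Gk]] pos
      by (intro mult_right_mono sum_mono) auto
    finally show ?thesis
      using pos by (simp add: b_def divide_simps)
  qed
  have "b 1 \<le> 1"
  proof (rule ccontr)
    assume "\<not> b 1 \<le> 1"
    then obtain j where "real n * (real n * c) < b 1 ^ j"
      using real_arch_pow[of "b 1"] by auto
    also have "\<dots> \<le> b 1 ^ (2 ^ j)"
      using \<open>\<not> b 1 \<le> 1\<close> less_exp[of j] by (intro power_increasing) auto
    also have "\<dots> \<le> real n * (real n * c)"
      using power[of j] bounded[of "2 ^ j"] by linarith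
    finally show False
      by simp
  qed
  then show ?thesis
    using pos by (simp add: b_def f_def)
qed

text \<open>The eigenvalue equals the Rayleigh quotient of \<open>T * mat_adjoint T\<close> at an
  eigenvector v, and this is the square of the norm of (adjoint of T) v divided by the norm of v.
  Hence it is real and nonnegative.\<close>

lemma is_singular_value_if_eigenvalue:
  fixes T :: "complex mat"
  assumes T: "T \<in> carrier_mat n n" and "eigenvalue (T * mat_adjoint T) e"
  obtains s where "is_singular_value T s" "e = complex_of_real (s\<^sup>2)"
proof -
  have T': "mat_adjoint T \<in> carrier_mat n n"
    by (rule mat_adjoint_carrier[OF T])
  obtain v where v: "v \<in> carrier_vec n" "v \<noteq> 0\<^sub>v n" "T * mat_adjoint T *\<^sub>v v = e \<cdot>\<^sub>v v"
    using assms by (auto simp: eigenvalue_def eigenvector_def)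
  define s where "s = vnorm (mat_adjoint T *\<^sub>v v) / vnorm v"
  have "e * complex_of_real ((vnorm v)\<^sup>2) = (e \<cdot>\<^sub>v v) \<bullet>c v"
    using v(1) by (simp add: cscalar_prod_self)
  also have "\<dots> = (T *\<^sub>v (mat_adjoint T *\<^sub>v v)) \<bullet>c v"
    unfolding v(3)[symmetric] assoc_mult_mat_vec[OF T T' v(1)] ..
  also have "\<dots> = complex_of_real ((vnorm (mat_adjoint T *\<^sub>v v))\<^sup>2)"
    using cscalar_prod_adjoint[OF T mult_mat_vec_carrier[OF T' v(1)] v(1)]
    by (simp add: cscalar_prod_self)
  finally have "e = complex_of_real (s\<^sup>2)"
    using vnorm_pos[OF v(1,2)] by (simp add: s_def field_simps)
  moreover have "is_singular_value T s"
    using assms(2) vnorm_nonneg unfolding \<open>e = complex_of_real (s\<^sup>2)\<close> is_singular_value_def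
    by (simp add: s_def)
  ultimately show thesis
    by (rule that[rotated])
qed

text \<open>Let H = T T* and let B be the inverse of T. The eigenvalues of H exceed \<eta>^2, so
  those of the self-adjoint matrix G = \<eta>^2 B* B, which is \<eta>^2 times the inverse of H, have
  modulus below 1. Then the powers of G are bounded and G is a contraction. For x = T v this gives
  \<eta>^2 |v|^2 = <x, G x> \<le> |x|^2, with no diagonalization of H.\<close>

lemma vnorm_mult_ge_of_no_small_singular_value:
  fixes T :: "complex mat"
  assumes T: "T \<in> carrier_mat n n" and "\<eta> > 0"
    and sing: "\<And>s. s \<in> {0..\<eta>} \<Longrightarrow> \<not> is_singular_value T s" and v: "v \<in> carrier_vec n"
  shows "\<eta> * vnorm v \<le> vnorm (T *\<^sub>v v)"
proof (cases "n = 0")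
  case True
  then show ?thesis
    using v by (simp add: vnorm_def)
next
  case False
  define H where "H = T * mat_adjoint T"
  have T': "mat_adjoint T \<in> carrier_mat n n"
    by (rule mat_adjoint_carrier[OF T])
  have H: "H \<in> carrier_mat n n"
    using T T' by (simp add: H_def)
  have ev_H: "\<eta>\<^sup>2 < cmod e" if e: "eigenvalue H e" for e
  proof -
    obtain s where s: "is_singular_value T s" "e = complex_of_real (s\<^sup>2)"
      using is_singular_value_if_eigenvalue[OF T e[unfolded H_def]] .
    then have "\<eta> < s"
      using sing[of s] by (auto simp: is_singular_value_def intro: not_le_imp_less)
    then show ?thesis
      using \<open>\<eta> > 0\<close> by (simp add: s(2) norm_power power_strict_mono)
  qed
  \<comment> \<open>0 is not an eigenvalue of \<open>H\<close>, hence \<open>H\<close> and with it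
    \<open>T\<close> are invertible.\<close>
  have "char_matrix H 0 = H"
    using H by (intro eq_matI) (auto simp: char_matrix_def)
  then have "det H \<noteq> 0"
    using ev_H[of 0] eigenvalue_det[OF H, of 0] by auto
  then have "det T \<noteq> 0"
    using det_mult[OF T T'] by (auto simp: H_def)
  then obtain B where B: "B \<in> carrier_mat n n" and BT: "B * T = 1\<^sub>m n" and TB: "T * B = 1\<^sub>m n"
    using det_non_zero_imp_unit[OF T, of undefined] by (auto simp: Units_def ring_mat_def)
  define B' where "B' = mat_adjoint B"
  have B': "B' \<in> carrier_mat n n"
    unfolding B'_def by (rule mat_adjoint_carrier[OF B])
  define a where "a = complex_of_real (\<eta>\<^sup>2)"
  define G where "G = a \<cdot>\<^sub>m (B' * B)"
  have G: "G \<in> carrier_mat n n"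
    using B B' by (simp add: G_def)
  have G_mult: "G *\<^sub>v w = a \<cdot>\<^sub>v (B' *\<^sub>v (B *\<^sub>v w))" if "w \<in> carrier_vec n" for w
  proof -
    have "(a \<cdot>\<^sub>m K) *\<^sub>v w = a \<cdot>\<^sub>v (K *\<^sub>v w)" if "K \<in> carrier_mat n n" for K
      using that \<open>w \<in> carrier_vec n\<close> by (intro eq_vecI) auto
    then have "G *\<^sub>v w = a \<cdot>\<^sub>v (B' * B *\<^sub>v w)"
      using mult_carrier_mat[OF B' B] unfolding G_def by blast
    then show ?thesis
      using assoc_mult_mat_vec[OF B' B that] by simp
  qed
  have "mat_adjoint (B' * B) = B' * B"
    using mat_adjoint_mult[OF B' B] by (simp add: B'_def)
  moreover have "mat_adjoint G = a \<cdot>\<^sub>m mat_adjoint (B' * B)"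
    using mat_adjoint_carrier[OF G] mat_adjoint_carrier[OF mult_carrier_mat[OF B' B]] G B B'
    by (intro eq_matI) (auto simp: G_def a_def mat_adjoint_index)
  ultimately have G_adj: "mat_adjoint G = G"
    by (simp add: G_def)
  have T'B': "mat_adjoint T * B' = 1\<^sub>m n"
    using mat_adjoint_mult[OF B T] BT by (simp add: B'_def mat_adjoint_one)
  \<comment> \<open>\<open>G\<close> is a times the inverse of \<open>H\<close>, checked factor by
    factor on a vector.\<close>
  have HG: "H *\<^sub>v (G *\<^sub>v w) = a \<cdot>\<^sub>v w" if w: "w \<in> carrier_vec n" for w
  proof -
    have Bw: "B *\<^sub>v w \<in> carrier_vec n"
      using B w by simp
    have B'Bw: "B' *\<^sub>v (B *\<^sub>v w) \<in> carrier_vec n"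
      using B' Bw by simp
    have "H *\<^sub>v (G *\<^sub>v w) = a \<cdot>\<^sub>v (H *\<^sub>v (B' *\<^sub>v (B *\<^sub>v w)))"
      unfolding G_mult[OF w] by (rule mult_mat_vec[OF H B'Bw])
    also have "H *\<^sub>v (B' *\<^sub>v (B *\<^sub>v w)) = T *\<^sub>v (mat_adjoint T *\<^sub>v (B' *\<^sub>v (B *\<^sub>v w)))"
      unfolding H_def by (rule assoc_mult_mat_vec[OF T T' B'Bw])
    also have "mat_adjoint T *\<^sub>v (B' *\<^sub>v (B *\<^sub>v w)) = B *\<^sub>v w"
      using assoc_mult_mat_vec[OF T' B' Bw] T'B' Bw by simp
    also have "T *\<^sub>v (B *\<^sub>v w) = w"
      using assoc_mult_mat_vec[OF T B w] TB w by simp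
    finally show ?thesis .
  qed
  \<comment> \<open>An eigenvector of \<open>G\<close> for e is one of \<open>H\<close> for a / e,
    and the latter eigenvalue has modulus above a = \<eta>^2.\<close>
  have ev_G: "cmod e < 1" if e: "eigenvalue G e" for e
  proof -
    obtain w where w: "w \<in> carrier_vec n" "w \<noteq> 0\<^sub>v n" "G *\<^sub>v w = e \<cdot>\<^sub>v w"
      using e G by (auto simp: eigenvalue_def eigenvector_def)
    have eq: "e \<cdot>\<^sub>v (H *\<^sub>v w) = a \<cdot>\<^sub>v w"
      using HG[OF w(1)] mult_mat_vec[OF H w(1)] by (simp add: w(3))
    have "a \<noteq> 0"
      using \<open>\<eta> > 0\<close> by (simp add: a_def)
    have "vnorm (a \<cdot>\<^sub>v w) \<noteq> 0"
      using vnorm_pos[OF w(1,2)] \<open>a \<noteq> 0\<close> by (simp add: vnorm_smult)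
    then have "e \<noteq> 0"
      unfolding eq[symmetric] by (auto simp: vnorm_smult)
    have "H *\<^sub>v w = inverse e \<cdot>\<^sub>v (e \<cdot>\<^sub>v (H *\<^sub>v w))"
      using \<open>e \<noteq> 0\<close> by (simp add: smult_smult_assoc)
    also have "\<dots> = (inverse e * a) \<cdot>\<^sub>v w"
      unfolding eq by (simp add: smult_smult_assoc)
    finally have "eigenvalue H (inverse e * a)"
      using w H by (auto simp: eigenvalue_def eigenvector_def)
    from ev_H[OF this] show ?thesis
      using \<open>e \<noteq> 0\<close> \<open>\<eta> > 0\<close> by (simp add: a_def norm_mult norm_inverse norm_divide norm_power field_simps)
  qed
  \<comment> \<open>The spectral radius is attained by an eigenvalue only if the spectrum is
    nonempty, which is why n = 0 was treated apart.\<close>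
  have "spectral_radius G < 1"
    using spectral_radius_mem_max(1)[OF G] False ev_G by (auto simp: spectrum_def)
  then obtain c where "\<And>k. norm_bound (G ^\<^sub>m k) c"
    using spectral_radius_jnf_norm_bound_less_1_upper_triangular[OF G] by blast
  then have contr: "vnorm (G *\<^sub>v (T *\<^sub>v v)) \<le> vnorm (T *\<^sub>v v)"
    using T v by (intro self_adjoint_power_bounded_imp_contraction[OF G G_adj]) auto
  have Tv: "T *\<^sub>v v \<in> carrier_vec n"
    using T v by simp
  have BTv: "B *\<^sub>v (T *\<^sub>v v) = v"
    using assoc_mult_mat_vec[OF B T v] BT v by simp
  have "(\<eta> * vnorm v)\<^sup>2 = \<eta>\<^sup>2 * cmod ((B *\<^sub>v (T *\<^sub>v v)) \<bullet>c v)"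
    unfolding BTv cscalar_prod_self by (simp add: power_mult_distrib norm_power)
  also have "\<dots> = \<eta>\<^sup>2 * cmod ((T *\<^sub>v v) \<bullet>c (B' *\<^sub>v v))"
    using cscalar_prod_adjoint[OF B Tv v] by (simp add: B'_def)
  also have "\<dots> \<le> \<eta>\<^sup>2 * (vnorm (T *\<^sub>v v) * vnorm (B' *\<^sub>v v))"
    using B' v by (intro mult_left_mono cmod_cscalar_prod_le[OF Tv]) auto
  also have "\<dots> = vnorm (T *\<^sub>v v) * vnorm (G *\<^sub>v (T *\<^sub>v v))"
    unfolding G_mult[OF Tv] BTv vnorm_smult by (simp add: a_def norm_power)
  also have "\<dots> \<le> (vnorm (T *\<^sub>v v))\<^sup>2"
    using contr by (simp add: power2_eq_square mult_left_mono)
  finally show ?thesis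
    by (rule power2_le_imp_le) simp
qed

section \<open>Sequences of holomorphic functions\<close>

text \<open>A version of Montel's theorem in which the members of the sequence need not be holomorphic on a
  common domain: near each point of \<open>D\<close> finitely many of them are exempted, and \<open>D\<close> need not be open.\<close>

lemma Montel_eventually:
  fixes f :: "nat \<Rightarrow> complex \<Rightarrow> complex"
  assumes loc: "\<And>z. z \<in> D \<Longrightarrow> \<exists>e>0. \<exists>B. \<forall>\<^sub>F n in sequentially.
                f n holomorphic_on ball z e \<and> (\<forall>w\<in>ball z e. cmod (f n w) \<le> B)"
  obtains m g V where "strict_mono (m :: nat \<Rightarrow> nat)" "open V" "D \<subseteq> V" "connected D \<Longrightarrow> connected V"
    "g holomorphic_on V"
    "\<And>K. compact K \<Longrightarrow> K \<subseteq> V \<Longrightarrow> uniform_limit K (\<lambda>k. f (m k)) g sequentially"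
proof (cases "D = {}")
  case True
  then show thesis
    by (intro that[of id "{}" "\<lambda>_. 0"]) (auto simp: strict_mono_def)
next
  case False
  define P where "P z e B \<longleftrightarrow> (\<forall>\<^sub>F n in sequentially.
      f n holomorphic_on ball z e \<and> (\<forall>w\<in>ball z e. cmod (f n w) \<le> B))" for z e B
  have "\<exists>e>0. \<exists>B. P z e B" if "z \<in> D" for z
    unfolding P_def using loc[OF that] .
  then obtain e B where e: "\<And>z. z \<in> D \<Longrightarrow> e z > 0" and P: "\<And>z. z \<in> D \<Longrightarrow> P z (e z) (B z)"
    by metis
  note good = P[unfolded P_def]
  \<comment> \<open>Countably many balls allow a diagonal extraction. The radii are halved so that
    the closed balls on which convergence is sought are compact subsets of the balls carrying the
    bounds.\<close>
  obtain C where C: "countable C" "C \<subseteq> D" "D \<subseteq> (\<Union>z\<in>C. ball z (e z / 2))"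
  proof -
    obtain \<F> where \<F>: "\<F> \<subseteq> (\<lambda>z. ball z (e z / 2)) ` D" "countable \<F>"
        "\<Union>\<F> = \<Union>((\<lambda>z. ball z (e z / 2)) ` D)"
      using Lindelof[of "(\<lambda>z. ball z (e z / 2)) ` D"] by auto
    obtain C where "countable C" "C \<subseteq> D" "\<F> = (\<lambda>z. ball z (e z / 2)) ` C"
      using \<F>(1,2) countable_subset_image[of \<F> "\<lambda>z. ball z (e z / 2)" D] by blast
    moreover have "D \<subseteq> \<Union>((\<lambda>z. ball z (e z / 2)) ` D)"
      using e by force
    ultimately show thesis
      using that \<F>(3) by metis
  qed
  define c where "c = from_nat_into C"
  have "C \<noteq> {}"
    using C False by auto
  then have range_c: "range c = C"
    unfolding c_def using C(1) by (rule range_from_nat_into)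
  have c_D: "c i \<in> D" for i
    using range_c C(2) by auto
  \<comment> \<open>Exempted members are replaced by 0, so that the whole sequence is holomorphic
    and bounded on the i-th ball and the usual Montel theorem applies. For each i only finitely many
    members change.\<close>
  define F where "F i n = (if f n holomorphic_on ball (c i) (e (c i)) \<and>
      (\<forall>w\<in>ball (c i) (e (c i)). cmod (f n w) \<le> B (c i)) then f n else (\<lambda>_. 0))" for i n
  have F_hol: "F i n holomorphic_on ball (c i) (e (c i))" for i n
    by (simp add: F_def)
  have F_bound: "cmod (F i n w) \<le> \<bar>B (c i)\<bar>" if "w \<in> ball (c i) (e (c i))" for i n w
    using that unfolding F_def by (auto intro: order_trans[OF _ abs_ge_self])
  have F_eq: "\<forall>\<^sub>F n in sequentially. F i n = f n" for i
    using good[OF c_D[of i]] by eventually_elim (simp add: F_def)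
  define Q where "Q i r \<longleftrightarrow> (\<exists>g. uniform_limit (cball (c i) (e (c i) / 2)) (\<lambda>k. F i (r k)) g sequentially)"
    for i r
  obtain m where m: "strict_mono (m :: nat \<Rightarrow> nat)" "\<And>i. Q i (id \<circ> m)"
  proof (rule subsequence_diagonalization_lemma[of Q id])
    fix i and r :: "nat \<Rightarrow> nat"
    obtain g k where k: "strict_mono (k :: nat \<Rightarrow> nat)"
      and lim: "\<And>K. compact K \<Longrightarrow> K \<subseteq> ball (c i) (e (c i)) \<Longrightarrow> uniform_limit K ((\<lambda>n. F i (r n)) \<circ> k) g sequentially"
    proof (rule Montel[of "ball (c i) (e (c i))" "range (\<lambda>n. F i (r n))" "\<lambda>n. F i (r n)"])
      show "\<exists>B. \<forall>h\<in>range (\<lambda>n. F i (r n)). \<forall>z\<in>K. cmod (h z) \<le> B" if "K \<subseteq> ball (c i) (e (c i))" for K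
        using that F_bound by blast
      show "h holomorphic_on ball (c i) (e (c i))" if "h \<in> range (\<lambda>n. F i (r n))" for h
        using that F_hol by blast
      fix g and k :: "nat \<Rightarrow> nat"
      assume "strict_mono k"
        and "\<And>K. compact K \<Longrightarrow> K \<subseteq> ball (c i) (e (c i)) \<Longrightarrow> uniform_limit K ((\<lambda>n. F i (r n)) \<circ> k) g sequentially"
      then show thesis
        by (rule that)
    qed simp_all
    have "cball (c i) (e (c i) / 2) \<subseteq> ball (c i) (e (c i))"
      using e[OF c_D[of i]] by auto
    from lim[OF compact_cball this] show "\<exists>k. strict_mono k \<and> Q i (r \<circ> k)"
      unfolding Q_def o_def using k by blast
  next
    \<comment> \<open>The diagonal sequence is a subsequence of the i-th extracted one only from
      some index on; convergence survives this because each late index of \<open>k2\<close> is an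
      index of \<open>k1\<close> at least as far out.\<close>
    fix i N and r k1 k2 :: "nat \<Rightarrow> nat"
    assume "Q i (r \<circ> k1)" and k2: "\<And>j. N \<le> j \<Longrightarrow> \<exists>j'\<ge>j. k2 j = k1 j'"
    then obtain g where g: "uniform_limit (cball (c i) (e (c i) / 2)) (\<lambda>k. F i ((r \<circ> k1) k)) g sequentially"
      unfolding Q_def by blast
    have "uniform_limit (cball (c i) (e (c i) / 2)) (\<lambda>k. F i ((r \<circ> k2) k)) g sequentially"
    proof (rule uniform_limitI)
      fix \<epsilon> :: real assume "\<epsilon> > 0"
      then obtain N' where N': "\<forall>k\<ge>N'. \<forall>x\<in>cball (c i) (e (c i) / 2). dist (F i ((r \<circ> k1) k) x) (g x) < \<epsilon>"
        using uniform_limitD[OF g] unfolding eventually_sequentially by blast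
      have "\<forall>x\<in>cball (c i) (e (c i) / 2). dist (F i ((r \<circ> k2) k) x) (g x) < \<epsilon>" if k: "max N N' \<le> k" for k
      proof -
        obtain j' where "j' \<ge> k" "k2 k = k1 j'"
          using k2[of k] k by auto
        then show ?thesis
          using N'[rule_format, of j'] k by auto
      qed
      then show "\<forall>\<^sub>F k in sequentially. \<forall>x\<in>cball (c i) (e (c i) / 2). dist (F i ((r \<circ> k2) k) x) (g x) < \<epsilon>"
        unfolding eventually_sequentially by blast
    qed
    then show "Q i (r \<circ> k2)"
      unfolding Q_def by blast
  qed (use that in blast)
  \<comment> \<open>The limits on the various balls are glued by taking the pointwise limit, which
    agrees with each of them.\<close>
  define g where "g x = lim (\<lambda>k. f (m k) x)" for x
  have lim_cball: "uniform_limit (cball (c i) (e (c i) / 2)) (\<lambda>k. f (m k)) g sequentially" for i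
  proof -
    obtain h where h: "uniform_limit (cball (c i) (e (c i) / 2)) (\<lambda>k. F i (m k)) h sequentially"
      using m(2)[of i] unfolding Q_def by auto
    have ev: "\<forall>\<^sub>F k in sequentially. F i (m k) = f (m k)"
      using eventually_subseq[OF m(1) F_eq[of i]] .
    have h': "uniform_limit (cball (c i) (e (c i) / 2)) (\<lambda>k. f (m k)) h sequentially"
      using h ev by (subst uniform_limit_cong[where g = "\<lambda>k. F i (m k)"]) (auto elim: eventually_mono)
    have "g x = h x" if "x \<in> cball (c i) (e (c i) / 2)" for x
      unfolding g_def by (rule limI, rule tendsto_uniform_limitI[OF h' that])
    then show ?thesis
      using h' by (subst uniform_limit_cong'[where i = h]) auto
  qed
  have g_hol: "g holomorphic_on ball (c i) (e (c i) / 2)" for i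
  proof (rule holomorphic_uniform_limit[OF _ lim_cball[of i]])
    have sub: "cball (c i) (e (c i) / 2) \<subseteq> ball (c i) (e (c i))"
      using e[OF c_D[of i]] by auto
    show "\<forall>\<^sub>F k in sequentially. continuous_on (cball (c i) (e (c i) / 2)) (f (m k)) \<and>
        f (m k) holomorphic_on ball (c i) (e (c i) / 2)"
      using eventually_subseq[OF m(1) good[OF c_D[of i]]]
    proof eventually_elim
      case (elim k)
      then have "f (m k) holomorphic_on cball (c i) (e (c i) / 2)"
        using sub by (auto intro: holomorphic_on_subset)
      then show ?case
        by (meson ball_subset_cball holomorphic_on_imp_continuous_on holomorphic_on_subset)
    qed
  qed auto
  define V where "V = (\<Union>i. ball (c i) (e (c i) / 2))"
  show thesis
  proof (rule that[of m V g])
    show "strict_mono m" "open V"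
      using m by (auto simp: V_def)
    have V_eq: "V = (\<Union>z\<in>C. ball z (e z / 2))"
      unfolding V_def range_c[symmetric] by simp
    then show DV: "D \<subseteq> V"
      using C by simp
    show "connected V" if "connected D"
    proof -
      \<comment> \<open>\<open>D\<close> is added to each ball: the resulting sets are connected,
        since the centers lie in \<open>D\<close>, and they all share \<open>D\<close>.\<close>
      have "V = (\<Union>z\<in>C. D \<union> ball z (e z / 2))"
        using DV \<open>C \<noteq> {}\<close> V_eq by auto
      moreover have "connected (\<Union>z\<in>C. D \<union> ball z (e z / 2))"
      proof (rule connected_Union)
        show "connected S" if S: "S \<in> (\<lambda>z. D \<union> ball z (e z / 2)) ` C" for S
        proof -
          obtain z where z: "z \<in> C" "S = D \<union> ball z (e z / 2)"
            using S by blast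
          then have "z \<in> D \<inter> ball z (e z / 2)"
            using C e[of z] by auto
          then show ?thesis
            unfolding z(2) using \<open>connected D\<close> by (intro connected_Un) auto
        qed
        show "\<Inter>((\<lambda>z. D \<union> ball z (e z / 2)) ` C) \<noteq> {}"
          using False \<open>C \<noteq> {}\<close> by auto
      qed
      ultimately show ?thesis
        by simp
    qed
    show "g holomorphic_on V"
      unfolding V_def by (intro holomorphic_on_UN_open g_hol) auto
    show "uniform_limit K (\<lambda>k. f (m k)) g sequentially" if K: "compact K" "K \<subseteq> V" for K
    proof -
      obtain I where I: "finite I" "K \<subseteq> (\<Union>i\<in>I. ball (c i) (e (c i) / 2))"
        using compactE_image[OF K(1), of UNIV "\<lambda>i. ball (c i) (e (c i) / 2)"] K(2)
        by (auto simp: V_def)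
      have "uniform_limit (\<Union>i\<in>I. ball (c i) (e (c i) / 2)) (\<lambda>k. f (m k)) g sequentially"
        using I(1) by (intro uniform_limit_on_UNION uniform_limit_on_subset[OF lim_cball ball_subset_cball])
      then show ?thesis
        using I(2) by (rule uniform_limit_on_subset)
    qed
  qed
qed

section \<open>Choice of circles and lower bounds on compact sets\<close>

text \<open>Only countably many radii are distances from z to a point of \<open>Z\<close>, whereas
  the interval of admissible radii is uncountable. Its left end is cut off at 0 to keep the radius
  positive.\<close>

lemma circle_avoiding_countable:
  fixes z :: complex and t \<delta> :: real
  assumes "countable Z" "t > 0" "\<delta> > 0"
  obtains t' where "0 < t'" "t - \<delta> < t'" "t' \<le> t" "sphere z t' \<inter> Z = {}"
proof -
  have "uncountable {max 0 (t - \<delta>)<..<t}"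
    using assms by (simp add: uncountable_open_interval)
  then have "\<not> {max 0 (t - \<delta>)<..<t} \<subseteq> dist z ` Z"
    using countable_subset[OF _ countable_image[OF assms(1)]] by blast
  then obtain t' where "t' \<in> {max 0 (t - \<delta>)<..<t}" "t' \<notin> dist z ` Z"
    by blast
  then show thesis
    by (intro that[of t']) auto
qed

lemma positive_lower_bound_on_compact:
  fixes f :: "'a :: topological_space \<Rightarrow> complex"
  assumes "compact K" "continuous_on K f" "\<And>w. w \<in> K \<Longrightarrow> f w \<noteq> 0"
  obtains \<epsilon> where "\<epsilon> > 0" "\<And>w. w \<in> K \<Longrightarrow> \<epsilon> \<le> cmod (f w)"
proof (cases "K = {}")
  case True
  then show thesis
    using that[of 1] by simp
next
  case False
  then obtain x where "x \<in> K" "\<And>w. w \<in> K \<Longrightarrow> cmod (f x) \<le> cmod (f w)"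
    using continuous_attains_inf[OF assms(1) False continuous_on_norm[OF assms(2)]] by blast
  then show thesis
    using that[of "cmod (f x)"] assms(3) by simp
qed

text \<open>From some index on, half of a lower bound for |g| works by uniform convergence. The
  finitely many earlier functions each have a positive lower bound of their own, and the least of
  all these bounds is taken.\<close>

lemma uniform_positive_lower_bound_on_compact:
  fixes f :: "nat \<Rightarrow> 'a :: topological_space \<Rightarrow> complex"
  assumes "compact K" and lim: "uniform_limit K f g sequentially"
    and g: "continuous_on K g" "\<And>w. w \<in> K \<Longrightarrow> g w \<noteq> 0"
    and f: "\<And>k. continuous_on K (f k)" "\<And>k w. w \<in> K \<Longrightarrow> f k w \<noteq> 0"
  shows "\<exists>\<epsilon>>0. \<forall>k. \<forall>w\<in>K. \<epsilon> \<le> cmod (f k w)"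
proof -
  obtain \<epsilon> where \<epsilon>: "\<epsilon> > 0" "\<And>w. w \<in> K \<Longrightarrow> \<epsilon> \<le> cmod (g w)"
    using positive_lower_bound_on_compact[OF assms(1) g] by blast
  obtain k0 where k0: "\<And>k w. k0 \<le> k \<Longrightarrow> w \<in> K \<Longrightarrow> dist (f k w) (g w) < \<epsilon> / 2"
    using uniform_limitD[OF lim, of "\<epsilon> / 2"] \<epsilon>(1) unfolding eventually_sequentially by force
  have tail: "\<epsilon> / 2 \<le> cmod (f k w)" if "k0 \<le> k" "w \<in> K" for k w
    using k0[OF that] \<epsilon>(2)[OF that(2)] norm_triangle_ineq2[of "g w" "f k w"]
    by (simp add: dist_norm norm_minus_commute)
  have "\<exists>d>0. d \<le> \<epsilon> / 2 \<and> (\<forall>k<n. \<forall>w\<in>K. d \<le> cmod (f k w))" for n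
  proof (induction n)
    case 0
    then show ?case
      using \<epsilon>(1) by (intro exI[of _ "\<epsilon> / 2"]) auto
  next
    case (Suc n)
    then obtain d where d: "d > 0" "d \<le> \<epsilon> / 2" "\<And>k w. k < n \<Longrightarrow> w \<in> K \<Longrightarrow> d \<le> cmod (f k w)"
      by blast
    obtain d' where d': "d' > 0" "\<And>w. w \<in> K \<Longrightarrow> d' \<le> cmod (f n w)"
      using positive_lower_bound_on_compact[OF assms(1) f(1)[of n] f(2)[of _ n]] by blast
    show ?case
      using d d' by (intro exI[of _ "min d d'"]) (auto simp: less_Suc_eq min_le_iff_disj)
  qed
  from this[of k0] obtain d where "d > 0" "d \<le> \<epsilon> / 2" "\<And>k w. k < k0 \<Longrightarrow> w \<in> K \<Longrightarrow> d \<le> cmod (f k w)"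
    by blast
  with tail show ?thesis
    by (meson not_le_imp_less order_trans)
qed

section \<open>The ratio of determinants\<close>

lemma mat_shift_carrier: "B \<in> carrier_mat n n \<Longrightarrow> mat_shift B z \<in> carrier_mat n n"
  by (auto simp: mat_shift_def)

lemma mat_shift_mult_vec:
  assumes "B \<in> carrier_mat n n" "v \<in> carrier_vec n"
  shows "mat_shift B z *\<^sub>v v = B *\<^sub>v v + (- z) \<cdot>\<^sub>v v"
proof -
  have "mat_shift B z = B + (- z) \<cdot>\<^sub>m 1\<^sub>m n"
    using assms by (intro eq_matI) (auto simp: mat_shift_def)
  moreover have "((- z) \<cdot>\<^sub>m 1\<^sub>m n) *\<^sub>v v = (- z) \<cdot>\<^sub>v v"
    using assms by (intro eq_vecI) auto
  ultimately show ?thesis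
    using add_mult_distrib_mat_vec[OF assms(1) _ assms(2), of "(- z) \<cdot>\<^sub>m 1\<^sub>m n"] by simp
qed

lemma det_mat_shift:
  assumes B: "B \<in> carrier_mat n n"
  shows "det (mat_shift B z) = (- 1) ^ n * poly (char_poly B) z"
proof -
  have "mat_shift B z = (- 1) \<cdot>\<^sub>m (- char_matrix B z)"
    using B by (intro eq_matI) (auto simp: mat_shift_def char_matrix_def)
  moreover have "dim_col (- char_matrix B z) = n"
    using B by (simp add: char_matrix_def)
  ultimately show ?thesis
    by (simp add: char_poly_matrix[OF B])
qed

lemma char_poly_nonzero: "B \<in> carrier_mat n n \<Longrightarrow> char_poly (B :: complex mat) \<noteq> 0"
  using degree_monic_char_poly[of B n] by auto

text \<open>The signs (-1)^N cancel. At a root of the denominator both sides are 0 by convention, so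
  the equation holds everywhere.\<close>

lemma det_ratio_eq:
  assumes "A N \<in> carrier_mat N N" "A' N \<in> carrier_mat N N"
  shows "det_ratio A A' N z = poly (char_poly (A N)) z / poly (char_poly (A' N)) z"
  using assms by (simp add: det_ratio_def det_mat_shift)

text \<open>This carries a lower bound at the single point z over to all w close to z.\<close>

lemma vnorm_mat_shift_ge:
  assumes B: "B \<in> carrier_mat n n" and v: "v \<in> carrier_vec n"
  shows "vnorm (mat_shift B z *\<^sub>v v) - cmod (w - z) * vnorm v \<le> vnorm (mat_shift B w *\<^sub>v v)"
proof -
  have "mat_shift B z *\<^sub>v v = mat_shift B w *\<^sub>v v + (w - z) \<cdot>\<^sub>v v"
    unfolding mat_shift_mult_vec[OF B v] using B v
    by (intro eq_vecI) (auto simp: algebra_simps)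
  then show ?thesis
    using vnorm_add_le[of "mat_shift B w *\<^sub>v v" n "(w - z) \<cdot>\<^sub>v v"] mat_shift_carrier[OF B, of w] v
    by (simp add: vnorm_smult)
qed

text \<open>The difference of the two shifted matrices is \<open>A'' N\<close> in one order and
  \<open>- A'' N\<close> in the other.\<close>

lemma kernel_dim_uminus:
  fixes E :: "complex mat"
  shows "kernel_dim (- E) = kernel_dim E"
proof -
  have "v \<in> mat_kernel (- E) \<longleftrightarrow> v \<in> mat_kernel E" for v
  proof (cases "v \<in> carrier_vec (dim_col E)")
    case True
    have "(- E) *\<^sub>v v = - (E *\<^sub>v v)"
      using True by (intro eq_vecI) auto
    moreover have "- (E *\<^sub>v v) = 0\<^sub>v (dim_row E) \<longleftrightarrow> E *\<^sub>v v = 0\<^sub>v (dim_row E)"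
      by (intro uminus_zero_vec_eq carrier_vecI dim_mult_mat_vec)
    ultimately show ?thesis
      using True by (simp add: mat_kernel_def)
  qed (simp add: mat_kernel_def)
  then have "mat_kernel (- E) = mat_kernel E"
    by blast
  then show ?thesis
    by (simp add: kernel_dim_def)
qed

section \<open>Upper and lower bounds on the ratio for a single \<open>N\<close>\<close>

context
  fixes A A' A'' :: "nat \<Rightarrow> complex mat" and M :: real and r N :: nat
  assumes A': "A' N \<in> carrier_mat N N" and A'': "A'' N \<in> carrier_mat N N"
    and decomp: "A N = A' N + A'' N" and M: "op_norm (A' N) + op_norm (A'' N) \<le> M"
    and rank: "vec_space.rank N (A'' N) = r"
begin

lemma perturbed_carrier: "A N \<in> carrier_mat N N"
  using A' A'' decomp by simp

lemma
  assumes v: "v \<in> carrier_vec N"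
  shows vnorm_A'_le: "vnorm (A' N *\<^sub>v v) \<le> M * vnorm v"
    and vnorm_A''_le: "vnorm (A'' N *\<^sub>v v) \<le> M * vnorm v"
    and vnorm_A_le: "vnorm (A N *\<^sub>v v) \<le> M * vnorm v"
proof -
  have 1: "vnorm (A' N *\<^sub>v v) \<le> op_norm (A' N) * vnorm v"
    and 2: "vnorm (A'' N *\<^sub>v v) \<le> op_norm (A'' N) * vnorm v"
    using vnorm_mult_mat_vec_le[of v "A' N"] vnorm_mult_mat_vec_le[of v "A'' N"] v A' A'' by simp_all
  have "(op_norm (A' N) + op_norm (A'' N)) * vnorm v \<le> M * vnorm v"
    using M vnorm_nonneg by (rule mult_right_mono)
  then have 3: "op_norm (A' N) * vnorm v + op_norm (A'' N) * vnorm v \<le> M * vnorm v"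
    by (simp only: distrib_right)
  have 4: "0 \<le> op_norm (A' N) * vnorm v" "0 \<le> op_norm (A'' N) * vnorm v"
    by (intro mult_nonneg_nonneg op_norm_nonneg vnorm_nonneg)+
  show "vnorm (A' N *\<^sub>v v) \<le> M * vnorm v" "vnorm (A'' N *\<^sub>v v) \<le> M * vnorm v"
    using 1 2 3 4 by linarith+
  have "A N *\<^sub>v v = A' N *\<^sub>v v + A'' N *\<^sub>v v"
    unfolding decomp by (rule add_mult_distrib_mat_vec[OF A' A'' v])
  then have "vnorm (A N *\<^sub>v v) \<le> vnorm (A' N *\<^sub>v v) + vnorm (A'' N *\<^sub>v v)"
    using vnorm_add_le[OF mult_mat_vec_carrier[OF A' v] mult_mat_vec_carrier[OF A'' v]] by simp
  with 1 2 3 show "vnorm (A N *\<^sub>v v) \<le> M * vnorm v"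
    by linarith
qed

lemma norm_bound_nonneg: "0 \<le> M"
  using M op_norm_nonneg[of "A' N"] op_norm_nonneg[of "A'' N"] by linarith

lemma kernel_dim_A'': "N \<le> kernel_dim (A'' N) + r"
  using kernel_dim_rank[OF A''] rank by simp

lemma det_ratio_le:
  assumes "\<eta> > 0" and lower: "\<forall>v\<in>carrier_vec N. \<eta> * vnorm v \<le> vnorm (mat_shift (A' N) w *\<^sub>v v)"
  shows "det (mat_shift (A' N) w) \<noteq> 0" "cmod (det_ratio A A' N w) \<le> (1 + M / \<eta>) ^ r"
proof -
  have diff: "mat_shift (A' N) w - mat_shift (A N) w = - A'' N"
    using A' A'' by (intro eq_matI) (auto simp: mat_shift_def decomp)
  have "vnorm ((- A'' N) *\<^sub>v v) \<le> M * vnorm v" if v: "v \<in> carrier_vec N" for v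
  proof -
    have "(- A'' N) *\<^sub>v v = (- 1) \<cdot>\<^sub>v (A'' N *\<^sub>v v)"
      using A'' v by (intro eq_vecI) auto
    then show ?thesis
      using vnorm_A''_le[OF v] by (simp add: vnorm_smult)
  qed
  then have "\<forall>v\<in>carrier_vec N. vnorm ((mat_shift (A' N) w - mat_shift (A N) w) *\<^sub>v v) \<le> M * vnorm v"
    "N \<le> kernel_dim (mat_shift (A' N) w - mat_shift (A N) w) + r"
    unfolding diff using kernel_dim_A'' by (simp_all add: kernel_dim_uminus)
  note bound = cmod_det_le_of_low_rank_difference[OF mat_shift_carrier[OF perturbed_carrier]
      mat_shift_carrier[OF A'] lower \<open>\<eta> > 0\<close> this(1) norm_bound_nonneg this(2)]
  show *: "det (mat_shift (A' N) w) \<noteq> 0"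
    by (rule bound(1))
  show "cmod (det_ratio A A' N w) \<le> (1 + M / \<eta>) ^ r"
    using bound(2) * by (simp add: det_ratio_def norm_divide divide_simps)
qed

lemma det_ratio_ge:
  assumes z: "cmod z \<ge> M + 1"
  shows "1 / (1 + M) ^ r \<le> cmod (det_ratio A A' N z)"
proof -
  \<comment> \<open>For |z| \<ge> M + 1 the triangle inequality makes B - z bounded below by |z| - M
    \<ge> 1. It serves for both \<open>A N\<close> and \<open>A' N\<close>, and explains the
    constant 1 + M.\<close>
  have lower: "\<forall>v\<in>carrier_vec N. 1 * vnorm v \<le> vnorm (mat_shift B z *\<^sub>v v)"
    if B: "B \<in> carrier_mat N N" "\<forall>v\<in>carrier_vec N. vnorm (B *\<^sub>v v) \<le> M * vnorm v" for B
  proof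
    fix v :: "complex vec" assume v: "v \<in> carrier_vec N"
    have "(M + 1) * vnorm v \<le> cmod z * vnorm v"
      using z by (simp add: mult_right_mono)
    moreover have eq: "z \<cdot>\<^sub>v v = B *\<^sub>v v + (- 1) \<cdot>\<^sub>v (mat_shift B z *\<^sub>v v)"
      unfolding mat_shift_mult_vec[OF B(1) v] using B(1) v by (intro eq_vecI) auto
    have "vnorm (z \<cdot>\<^sub>v v) \<le> vnorm (B *\<^sub>v v) + vnorm ((- 1) \<cdot>\<^sub>v (mat_shift B z *\<^sub>v v))"
      unfolding eq
      by (intro vnorm_add_le[of _ N] smult_carrier_vec[THEN iffD2] mult_mat_vec_carrier[OF _ v] B(1) mat_shift_carrier)
    then have "cmod z * vnorm v \<le> vnorm (B *\<^sub>v v) + vnorm (mat_shift B z *\<^sub>v v)"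
      by (simp add: vnorm_smult)
    ultimately show "1 * vnorm v \<le> vnorm (mat_shift B z *\<^sub>v v)"
      using B(2)[rule_format, OF v] by (simp add: algebra_simps)
  qed
  have one: "(0 :: real) < 1"
    by simp
  have lower_A: "\<forall>v\<in>carrier_vec N. 1 * vnorm v \<le> vnorm (mat_shift (A N) z *\<^sub>v v)"
    and lower_A': "\<forall>v\<in>carrier_vec N. 1 * vnorm v \<le> vnorm (mat_shift (A' N) z *\<^sub>v v)"
    using lower[OF perturbed_carrier] lower[OF A'] vnorm_A_le vnorm_A'_le by simp_all
  have diff: "mat_shift (A N) z - mat_shift (A' N) z = A'' N"
    using A' A'' by (intro eq_matI) (auto simp: mat_shift_def decomp)
  have "\<forall>v\<in>carrier_vec N. vnorm ((mat_shift (A N) z - mat_shift (A' N) z) *\<^sub>v v) \<le> M * vnorm v"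
    "N \<le> kernel_dim (mat_shift (A N) z - mat_shift (A' N) z) + r"
    unfolding diff using kernel_dim_A'' vnorm_A''_le by auto
  note bound = cmod_det_le_of_low_rank_difference[OF mat_shift_carrier[OF A']
      mat_shift_carrier[OF perturbed_carrier] lower_A one this(1) norm_bound_nonneg this(2)]
  \<comment> \<open>A vanishing denominator would make the ratio 0 by convention, so it has to be
    excluded for a lower bound.\<close>
  have "det (mat_shift (A' N) z) \<noteq> 0"
    by (rule det_ratio_le(1)[OF one lower_A'])
  have "0 < (1 + M) ^ r"
    using norm_bound_nonneg by simp
  with bound \<open>det (mat_shift (A' N) z) \<noteq> 0\<close> show ?thesis
    by (simp add: det_ratio_def norm_divide field_simps)
qed

end

lemma det_ratio_holomorphic:
  assumes "A N \<in> carrier_mat N N" "A' N \<in> carrier_mat N N"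
  shows "open {w. det (mat_shift (A' N) w) \<noteq> 0}"
    and "det_ratio A A' N holomorphic_on {w. det (mat_shift (A' N) w) \<noteq> 0}"
proof -
  have eq: "det (mat_shift (A' N) w) \<noteq> 0 \<longleftrightarrow> poly (char_poly (A' N)) w \<noteq> 0" for w
    by (simp add: det_mat_shift[OF assms(2)])
  show "open {w. det (mat_shift (A' N) w) \<noteq> 0}"
    unfolding eq by (intro open_Collect_neq continuous_intros)
  have "(\<lambda>w. poly (char_poly (A N)) w / poly (char_poly (A' N)) w)
      holomorphic_on {w. det (mat_shift (A' N) w) \<noteq> 0}"
    unfolding eq by (intro holomorphic_intros) auto
  then show "det_ratio A A' N holomorphic_on {w. det (mat_shift (A' N) w) \<noteq> 0}"
    by (rule holomorphic_transform) (simp add: det_ratio_eq assms)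
qed

lemma converges_locally_uniformly_imp_tendsto:
  assumes "converges_locally_uniformly D F g" "z \<in> D"
  shows "(\<lambda>k. F k z) \<longlonglongrightarrow> g z"
proof -
  have "compact {z} \<and> {z} \<subseteq> D"
    using assms(2) by simp
  with assms(1) have "uniform_limit {z} F g sequentially"
    unfolding converges_locally_uniformly_def by blast
  then show ?thesis
    by (rule tendsto_uniform_limitI) simp
qed

theorem lemma1p6:
  fixes \<sigma> :: real and r :: nat and M :: real
    and A A' A'' :: "nat \<Rightarrow> complex mat"
    and \<nu> \<mu> :: "complex \<Rightarrow> real measure" and \<beta> :: "complex measure"
    and P :: "'w measure" and X :: "nat \<times> nat \<Rightarrow> 'w \<Rightarrow> complex"
    and S D :: "complex set"
  assumes sigma: "\<sigma> > 0"
    and dims: "\<And>N. N \<ge> 1 \<Longrightarrow> A' N \<in> carrier_mat N N \<and> A'' N \<in> carrier_mat N N"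
    and decomp: "\<And>N. N \<ge> 1 \<Longrightarrow> A N = A' N + A'' N"
    and M: "M > 0" "\<And>N. N \<ge> 1 \<Longrightarrow> op_norm (A' N) + op_norm (A'' N) \<le> M"
    and nu: "\<And>z. real_distribution (\<nu> z)"
            "\<And>z. weak_conv_m (\<lambda>N. esd_sq (mat_shift (A N) z)) (\<nu> z)"
    and iid: "iid_standard_array P X"
    and limits: "limit_measures P X \<sigma> A \<beta> \<mu>"
    and supp: "msupp \<beta> = {z. 0 \<in> msupp (\<mu> z)}"
    and S: "S = {z. 0 \<in> msupp (\<nu> z)}"
    and D: "D \<in> components (- S)" "\<not> bounded D"
    and rank: "eventually (\<lambda>N. vec_space.rank N (A'' N) = r) sequentially"
    and sing: "\<And>z. z \<in> D \<Longrightarrow> \<exists>\<eta>>0. eventually (\<lambda>N.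
                 \<not> (\<exists>s\<in>{0..\<eta>}. is_singular_value (mat_shift (A' N) z) s)) sequentially"
  shows "(\<forall>K. compact K \<and> K \<subseteq> D \<longrightarrow>
            eventually (\<lambda>N. (\<forall>z\<in>K. Determinant.det (mat_shift (A' N) z) \<noteq> 0) \<and>
                             det_ratio A A' N analytic_on K) sequentially)
    \<and> (\<forall>n :: nat \<Rightarrow> nat. strict_mono n \<longrightarrow>
         (\<exists>(m :: nat \<Rightarrow> nat) g. strict_mono m \<and> g analytic_on D \<and>
            converges_locally_uniformly D (\<lambda>k. det_ratio A A' (n (m k))) g))
    \<and> (\<forall>(n :: nat \<Rightarrow> nat) g. strict_mono n \<and> converges_locally_uniformly D (\<lambda>k. det_ratio A A' (n k)) g \<longrightarrow>
         (\<exists>z\<in>D. g z \<noteq> 0))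
    \<and> (\<forall>(n :: nat \<Rightarrow> nat) g. strict_mono n \<and> (\<forall>k. n k \<ge> 1) \<and>
           converges_locally_uniformly D (\<lambda>k. det_ratio A A' (n k)) g \<longrightarrow>
         (\<forall>z t \<delta>. t > 0 \<and> cball z t \<subseteq> D \<and> \<delta> > 0 \<longrightarrow>
            (\<exists>\<epsilon> t'. \<epsilon> > 0 \<and> t' > 0 \<and> t - \<delta> < t' \<and> t' \<le> t \<and>
               (\<forall>k. \<forall>w \<in> frontier (cball z t'). cmod (det_ratio A A' (n k) w) \<ge> \<epsilon>))))"
proof (intro conjI allI impI)
  let ?f = "det_ratio A A'"
  have A: "A N \<in> carrier_mat N N" if "N \<ge> 1" for N
    using dims[OF that] decomp[OF that] by simp
  have large: "\<forall>\<^sub>F N in sequentially. N \<ge> 1 \<and> vec_space.rank N (A'' N) = r"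
    using rank eventually_ge_at_top[of 1] by eventually_elim simp
  have loc: "\<exists>e>0. \<exists>B. \<forall>\<^sub>F N in sequentially. (\<forall>w\<in>ball z e. det (mat_shift (A' N) w) \<noteq> 0) \<and>
      ?f N holomorphic_on ball z e \<and> (\<forall>w\<in>ball z e. cmod (?f N w) \<le> B)" if z: "z \<in> D" for z
  proof -
    obtain \<eta> where \<eta>: "\<eta> > 0" and gap: "\<forall>\<^sub>F N in sequentially.
        \<not> (\<exists>s\<in>{0..\<eta>}. is_singular_value (mat_shift (A' N) z) s)"
      using sing[OF z] by blast
    \<comment> \<open>The gap \<eta> at z loses at most |w - z| on the way to w, so half of it
      remains on the ball of radius \<eta> / 2. The bound on the ratio there is free of
      \<open>N\<close>.\<close>
    have "\<forall>\<^sub>F N in sequentially. (\<forall>w\<in>ball z (\<eta> / 2). det (mat_shift (A' N) w) \<noteq> 0) \<and>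
      ?f N holomorphic_on ball z (\<eta> / 2) \<and> (\<forall>w\<in>ball z (\<eta> / 2). cmod (?f N w) \<le> (1 + M / (\<eta> / 2)) ^ r)"
      using large gap
    proof eventually_elim
      case (elim N)
      have "\<eta> / 2 * vnorm v \<le> vnorm (mat_shift (A' N) w *\<^sub>v v)"
        if "w \<in> ball z (\<eta> / 2)" "v \<in> carrier_vec N" for v w
      proof -
        have "\<eta> * vnorm v \<le> vnorm (mat_shift (A' N) z *\<^sub>v v)"
          using elim dims[of N] that \<eta>
          by (intro vnorm_mult_ge_of_no_small_singular_value[of _ N]) (auto intro: mat_shift_carrier)
        moreover have "cmod (w - z) * vnorm v \<le> \<eta> / 2 * vnorm v"
          using that by (intro mult_right_mono) (auto simp: dist_norm norm_minus_commute)
        ultimately show ?thesis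
          using vnorm_mat_shift_ge[of "A' N" N v z w] dims[of N] elim that by simp
      qed
      then have lower: "\<forall>v\<in>carrier_vec N. \<eta> / 2 * vnorm v \<le> vnorm (mat_shift (A' N) w *\<^sub>v v)"
        if "w \<in> ball z (\<eta> / 2)" for w
        using that by blast
      have bound: "det (mat_shift (A' N) w) \<noteq> 0" "cmod (?f N w) \<le> (1 + M / (\<eta> / 2)) ^ r"
        if "w \<in> ball z (\<eta> / 2)" for w
        using det_ratio_le[of A' N A'' A M r "\<eta> / 2" w] dims[of N] decomp[of N] M(2)[of N] elim \<eta>
          lower[OF that] by auto
      have "?f N holomorphic_on ball z (\<eta> / 2)"
        using det_ratio_holomorphic(2)[of A N A'] A[of N] dims[of N] elim bound(1)
        by (auto intro: holomorphic_on_subset)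
      with bound show ?case
        by blast
    qed
    then show ?thesis
      using \<eta> by (intro exI[of _ "\<eta> / 2"] conjI exI[of _ "(1 + M / (\<eta> / 2)) ^ r"]) auto
  qed
  \<comment> \<open>The open set \<open>V\<close> provides the neighbourhood that analyticity on
    \<open>D\<close> asks for; its connectedness will allow the identity theorem to be applied to
    the limit.\<close>
  have subsequence: "\<exists>m g V. strict_mono (m :: nat \<Rightarrow> nat) \<and> open V \<and> connected V \<and> D \<subseteq> V \<and>
      g holomorphic_on V \<and>
      (\<forall>K. compact K \<and> K \<subseteq> V \<longrightarrow> uniform_limit K (\<lambda>k. ?f (n (m k))) g sequentially)"
    if n: "strict_mono n" for n :: "nat \<Rightarrow> nat"
  proof -
    have loc_n: "\<exists>e>0. \<exists>B. \<forall>\<^sub>F k in sequentially. ?f (n k) holomorphic_on ball z e \<and>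
        (\<forall>w\<in>ball z e. cmod (?f (n k) w) \<le> B)" if z: "z \<in> D" for z
    proof -
      obtain e B where "e > 0" and ev: "\<forall>\<^sub>F N in sequentially. (\<forall>w\<in>ball z e. det (mat_shift (A' N) w) \<noteq> 0) \<and>
          ?f N holomorphic_on ball z e \<and> (\<forall>w\<in>ball z e. cmod (?f N w) \<le> B)"
        using loc[OF z] by blast
      have "\<forall>\<^sub>F k in sequentially. ?f (n k) holomorphic_on ball z e \<and>
          (\<forall>w\<in>ball z e. cmod (?f (n k) w) \<le> B)"
        using eventually_subseq[OF n ev] by eventually_elim blast
      with \<open>e > 0\<close> show ?thesis
        by blast
    qed
    show ?thesis
    proof (rule Montel_eventually[OF loc_n])
      fix m V g
      assume "strict_mono (m :: nat \<Rightarrow> nat)" "open V" "D \<subseteq> V"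
        "connected D \<Longrightarrow> connected V" "g holomorphic_on V"
        "\<And>K. compact K \<Longrightarrow> K \<subseteq> V \<Longrightarrow> uniform_limit K (\<lambda>k. ?f (n (m k))) g sequentially"
      then show ?thesis
        using in_components_connected[OF D(1)] by (intro exI[of _ m] exI[of _ g] exI[of _ V]) simp
    qed
  qed
  have nonzero: "\<exists>z\<in>D. g z \<noteq> 0"
    if n: "strict_mono n" and lim: "converges_locally_uniformly D (\<lambda>k. ?f (n k)) g" for n g
  proof -
    obtain z where z: "z \<in> D" "cmod z \<ge> M + 1"
      using D(2) unfolding bounded_iff by (meson le_cases)
    have "\<forall>\<^sub>F N in sequentially. 1 / (1 + M) ^ r \<le> cmod (?f N z)"
      using large
    proof eventually_elim
      case (elim N)
      then show ?case
        using det_ratio_ge[of A' N A'' A M r z] dims[of N] decomp[of N] M(2)[of N] z(2) by simp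
    qed
    then have ev: "\<forall>\<^sub>F k in sequentially. 1 / (1 + M) ^ r \<le> cmod (?f (n k) z)"
      by (rule eventually_subseq[OF n])
    have "(\<lambda>k. ?f (n k) z) \<longlonglongrightarrow> g z"
      using lim z(1) by (rule converges_locally_uniformly_imp_tendsto)
    then have "1 / (1 + M) ^ r \<le> cmod (g z)"
      using ev by (intro tendsto_lowerbound[OF tendsto_norm]) auto
    moreover have "0 < 1 / (1 + M) ^ r"
      using M(1) by simp
    ultimately show ?thesis
      using z(1) by (intro bexI[of _ z]) auto
  qed

  show "\<forall>\<^sub>F N in sequentially. (\<forall>z\<in>K. det (mat_shift (A' N) z) \<noteq> 0) \<and> ?f N analytic_on K"
    if K: "compact K \<and> K \<subseteq> D" for K
  proof -
    define P where "P z e \<longleftrightarrow>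
        (\<forall>\<^sub>F N in sequentially. \<forall>w\<in>ball z e. det (mat_shift (A' N) w) \<noteq> 0)" for z e
    have "\<exists>e>0. P z e" if z: "z \<in> D" for z
    proof -
      obtain e B where "e > 0" and ev: "\<forall>\<^sub>F N in sequentially. (\<forall>w\<in>ball z e. det (mat_shift (A' N) w) \<noteq> 0) \<and>
          ?f N holomorphic_on ball z e \<and> (\<forall>w\<in>ball z e. cmod (?f N w) \<le> B)"
        using loc[OF z] by blast
      from ev have "P z e"
        unfolding P_def by (rule eventually_mono) blast
      with \<open>e > 0\<close> show ?thesis
        by blast
    qed
    then obtain e where e: "\<And>z. z \<in> D \<Longrightarrow> e z > 0" and P: "\<And>z. z \<in> D \<Longrightarrow> P z (e z)"
      by metis
    \<comment> \<open>Finitely many balls cover \<open>K\<close>, so a single threshold for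
      \<open>N\<close> works on all of \<open>K\<close>.\<close>
    obtain C where C: "C \<subseteq> K" "finite C" "K \<subseteq> (\<Union>z\<in>C. ball z (e z))"
      using compactE_image[of K K "\<lambda>z. ball z (e z)"] K e by force
    have "\<forall>\<^sub>F N in sequentially. \<forall>z\<in>C. \<forall>w\<in>ball z (e z). det (mat_shift (A' N) w) \<noteq> 0"
      using C K P unfolding P_def by (intro eventually_ball_finite) auto
    then show ?thesis
      using large
    proof eventually_elim
      case (elim N)
      then have nz: "\<forall>z\<in>K. det (mat_shift (A' N) z) \<noteq> 0"
        using C(3) by blast
      have "?f N analytic_on {w. det (mat_shift (A' N) w) \<noteq> 0}"
        using det_ratio_holomorphic[of A N A'] A[of N] dims[of N] elim by (simp add: analytic_on_open)
      then show ?case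
        using nz by (auto intro: analytic_on_subset)
    qed
  qed

  show "\<exists>m g. strict_mono m \<and> g analytic_on D \<and> converges_locally_uniformly D (\<lambda>k. ?f (n (m k))) g"
    if n: "strict_mono n" for n :: "nat \<Rightarrow> nat"
  proof -
    obtain m g V where m: "strict_mono (m :: nat \<Rightarrow> nat)" and V: "open V" "D \<subseteq> V" "g holomorphic_on V"
      and lim: "\<forall>K. compact K \<and> K \<subseteq> V \<longrightarrow> uniform_limit K (\<lambda>k. ?f (n (m k))) g sequentially"
      using subsequence[OF n] by blast
    have "g analytic_on D"
      using V by (metis analytic_on_open analytic_on_subset)
    moreover have "converges_locally_uniformly D (\<lambda>k. ?f (n (m k))) g"
      using lim V(2) unfolding converges_locally_uniformly_def by blast
    ultimately show ?thesis
      using m by blast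
  qed

  show "\<exists>z\<in>D. g z \<noteq> 0"
    if "strict_mono n \<and> converges_locally_uniformly D (\<lambda>k. ?f (n k)) g" for n g
    using nonzero that by blast

  fix n :: "nat \<Rightarrow> nat" and g z and t \<delta> :: real
  assume "strict_mono n \<and> (\<forall>k. n k \<ge> 1) \<and> converges_locally_uniformly D (\<lambda>k. ?f (n k)) g"
    and "t > 0 \<and> cball z t \<subseteq> D \<and> \<delta> > 0"
  then have n: "strict_mono n" "\<And>k. n k \<ge> 1" and g: "converges_locally_uniformly D (\<lambda>k. ?f (n k)) g"
    and t: "t > 0" "cball z t \<subseteq> D" "\<delta> > 0"
    by auto
  \<comment> \<open>The given limit g comes only with its values on \<open>D\<close>. A further
    subsequence has a holomorphic limit h on \<open>V\<close>, and the two agree on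
    \<open>D\<close>, so g inherits the zeros and the regularity of h there.\<close>
  obtain m h V where m: "strict_mono (m :: nat \<Rightarrow> nat)"
    and V: "open V" "connected V" "D \<subseteq> V" "h holomorphic_on V"
    and h: "\<forall>K. compact K \<and> K \<subseteq> V \<longrightarrow> uniform_limit K (\<lambda>k. ?f (n (m k))) h sequentially"
    using subsequence[OF n(1)] by blast
  have g_eq: "g w = h w" if "w \<in> D" for w
  proof (rule LIMSEQ_unique)
    show "(\<lambda>k. ?f (n (m k)) w) \<longlonglongrightarrow> h w"
      using h that V(3)
      by (intro converges_locally_uniformly_imp_tendsto[of V]) (auto simp: converges_locally_uniformly_def)
    have "(\<lambda>k. ?f (n k) w) \<longlonglongrightarrow> g w"
      using g that by (rule converges_locally_uniformly_imp_tendsto)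
    then show "(\<lambda>k. ?f (n (m k)) w) \<longlonglongrightarrow> g w"
      using LIMSEQ_subseq_LIMSEQ[OF _ m] by (simp add: o_def)
  qed
  have finite_h: "finite {w \<in> cball z t. h w = 0}"
  \<comment> \<open>A nonconstant h has finitely many zeros in a compact set; a constant h has none
    in the disc because g does not vanish identically on \<open>D\<close>.\<close>
  proof (cases "h constant_on V")
    case True
    then obtain c where c: "\<And>w. w \<in> V \<Longrightarrow> h w = c"
      unfolding constant_on_def by blast
    obtain w where "w \<in> D" "g w \<noteq> 0"
      using nonzero[OF n(1) g] by blast
    then have "c \<noteq> 0"
      using c[of w] g_eq[of w] V(3) by auto
    then have "{w \<in> cball z t. h w = 0} = {}"
      using c t(2) V(3) by blast
    then show ?thesis
      by (simp only: finite.emptyI)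
  next
    case False
    then show ?thesis
      using t(2) V(3) by (intro holomorphic_compact_finite_zeros[OF V(4,1,2) compact_cball]) auto
  qed
  \<comment> \<open>The lower bound is wanted for every k, also for small ones whose ratio may have
    zeros or poles in \<open>D\<close>. Poles must be avoided too: the ratio is 0 there by
    convention.\<close>
  define Z where "Z = {w \<in> cball z t. h w = 0} \<union>
      (\<Union>k. {w. poly (char_poly (A (n k))) w = 0} \<union> {w. poly (char_poly (A' (n k))) w = 0})"
  have A_n: "A (n k) \<in> carrier_mat (n k) (n k)" and A'_n: "A' (n k) \<in> carrier_mat (n k) (n k)" for k
    using A[OF n(2)[of k]] dims[OF n(2)[of k]] by auto
  have "countable Z"
    unfolding Z_def
    by (intro countable_Un countable_UN countable_finite
        finite_h poly_roots_finite char_poly_nonzero[OF A_n] char_poly_nonzero[OF A'_n] countableI_type)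
  then obtain t' where t': "0 < t'" "t - \<delta> < t'" "t' \<le> t" "sphere z t' \<inter> Z = {}"
    using circle_avoiding_countable[OF _ t(1,3), of Z z] by blast
  have sub: "sphere z t' \<subseteq> cball z t"
    using t'(3) by auto
  then have sub_D: "sphere z t' \<subseteq> D" and sub_V: "sphere z t' \<subseteq> V"
    using t(2) V(3) by auto
  have "\<exists>\<epsilon>>0. \<forall>k. \<forall>w\<in>sphere z t'. \<epsilon> \<le> cmod (?f (n k) w)"
  proof (rule uniform_positive_lower_bound_on_compact)
    show "compact (sphere z t')"
      by (rule compact_sphere)
    \<comment> \<open>Convergence is used along the full sequence n here; the subsequence m served
      only to understand g.\<close>
    show "uniform_limit (sphere z t') (\<lambda>k. ?f (n k)) g sequentially"
      using g sub_D by (simp add: converges_locally_uniformly_def)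
    have "continuous_on (sphere z t') h"
      using V(4) sub_V by (meson continuous_on_subset holomorphic_on_imp_continuous_on)
    then show "continuous_on (sphere z t') g"
      using g_eq sub_D by (subst continuous_on_cong[OF refl, of _ g h]) auto
    show "g w \<noteq> 0" if "w \<in> sphere z t'" for w
    proof -
      have "w \<notin> Z" "w \<in> cball z t" "g w = h w"
        using that t'(4) sub sub_D g_eq by blast+
      then show ?thesis
        unfolding Z_def by (metis (mono_tags, lifting) UnI1 mem_Collect_eq)
    qed
    fix k
    have eq: "?f (n k) w = poly (char_poly (A (n k))) w / poly (char_poly (A' (n k))) w" for w
      by (rule det_ratio_eq) (rule A_n A'_n)+
    have nz: "poly (char_poly (A (n k))) w \<noteq> 0" "poly (char_poly (A' (n k))) w \<noteq> 0" if "w \<in> sphere z t'" for w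
      using that t'(4) unfolding Z_def by blast+
    show "continuous_on (sphere z t') (?f (n k))"
      unfolding eq[abs_def] using nz by (intro continuous_intros) auto
    show "?f (n k) w \<noteq> 0" if "w \<in> sphere z t'" for w
      unfolding eq using nz[OF that] by simp
  qed
  then show "\<exists>\<epsilon> t'. \<epsilon> > 0 \<and> t' > 0 \<and> t - \<delta> < t' \<and> t' \<le> t \<and>
      (\<forall>k. \<forall>w \<in> frontier (cball z t'). cmod (?f (n k) w) \<ge> \<epsilon>)"
    using t' by (auto simp: frontier_cball)
qed

end
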